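(* Let $\mathsf{M}$ and $\mathsf{N}$ be algebras with bracket (AWBs) with compatible actions on each other, let $\mathsf{M}\boxtimes\mathsf{N}$ be their non-abelian tensor product, and for a generator $g$ of $\mathsf{M}\boxtimes\mathsf{N}$ let $(g_{\mathsf{M}},g_{\mathsf{N}})$ be the pair defined by $$m\odot n\mapsto(m^{\cdot n},{}^{m\cdot}n),\quad n\odot m\mapsto({}^{n\cdot}m,n^{\cdot m}),\quad m\circledast n\mapsto(m^{\ast n},{}^{m\ast}n),\quad n\circledast m\mapsto({}^{n\ast}m,n^{\ast m}).$$ (a) There are homomorphisms of AWBs $\psi_{\mathsf{M}}:\mathsf{M}\boxtimes\mathsf{N}\to\mathsf{M}$ and $\psi_{\mathsf{N}}:\mathsf{M}\boxtimes\mathsf{N}\to\mathsf{N}$ given on generators by $\psi_{\mathsf{M}}(g)=g_{\mathsf{M}}$ and $\psi_{\mathsf{N}}(g)=g_{\mathsf{N}}$ (for example $\psi_{\mathsf{M}}(m\odot n)=m^{\cdot n}$, $\psi_{\mathsf{N}}(n\circledast m)=n^{\ast m}$). (b) There are actions of $\mathsf{M}$ and of $\mathsf{N}$ on $\mathsf{M}\boxtimes\mathsf{N}$ given, for all $m\in\mathsf{M}$, $n\in\mathsf{N}$ and all generators $g$, by $${}^{m\cdot}g=m\odot g_{\mathsf{N}},\quad g^{\cdot m}=g_{\mathsf{N}}\odot m,\quad {}^{m\ast}g=m\circledast g_{\mathsf{N}},\quad g^{\ast m}=g_{\mathsf{N}}\circledast m,$$ and $${}^{n\cdot}g=n\odot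 g_{\mathsf{M}},\quad g^{\cdot n}=g_{\mathsf{M}}\odot n,\quad {}^{n\ast}g=n\circledast g_{\mathsf{M}},\quad g^{\ast n}=g_{\mathsf{M}}\circledast n.$$ (c) The homomorphisms $\psi_{\mathsf{M}}$ and $\psi_{\mathsf{N}}$ together with the actions described in (b) are crossed modules of AWBs.
   Context: All vector spaces and algebras are over a fixed field $\mathbb{K}$. An algebra with bracket (AWB) is an associative, not necessarily commutative (and not necessarily unital) algebra $\mathsf{A}$ with a bilinear map $[-,-]:\mathsf{A}\times\mathsf{A}\to\mathsf{A}$ such that $[ab,c]=[a,c]b+a[b,c]$ for all $a,b,c$. Homomorphisms preserve product and bracket. Action: an action of an AWB $\mathsf{A}$ on an AWB $\mathsf{M}$ consists of four bilinear maps $(a,m)\mapsto{}^{a\cdot}m$, $(m,a)\mapsto m^{\cdot a}$, $(a,m)\mapsto{}^{a\ast}m$, $(m,a)\mapsto m^{\ast a}$ with values in $\mathsf{M}$ such that for all $a,a_1,a_2\in\mathsf{A}$, $m,m_1,m_2\in\mathsf{M}$: ${}^{(a_1a_2)\cdot}m={}^{a_1\cdot}({}^{a_2\cdot}m)$; $\ m^{\cdot(a_1a_2)}=(m^{\cdot a_1})^{\cdot a_2}$; $\ ({}^{a_1\cdot}m)^{\cdot a_2}={}^{a_1\cdot}(m^{\cdot a_2})$; $({}^{a_1\cdot}m)^{\ast a_2}={}^{a_1\cdot}(m^{\ast a_2})+{}^{[a_1,a_2]\cdot}m$; $\ (m^{\cdot a_1})^{\ast a_2}=(m^{\ast a_2})^{\cdot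 a_1}+m^{\cdot[a_1,a_2]}$; $\ {}^{(a_1a_2)\ast}m={}^{a_1\cdot}({}^{a_2\ast}m)+({}^{a_1\ast}m)^{\cdot a_2}$; $(m_1m_2)^{\cdot a}=m_1(m_2^{\cdot a})$; $\ {}^{a\cdot}(m_1m_2)=({}^{a\cdot}m_1)m_2$; $\ (m_1^{\cdot a})m_2=m_1({}^{a\cdot}m_2)$; $[m_1^{\cdot a},m_2]=m_1({}^{a\ast}m_2)+[m_1,m_2]^{\cdot a}$; $\ [{}^{a\cdot}m_1,m_2]={}^{a\cdot}[m_1,m_2]+({}^{a\ast}m_2)m_1$; $\ (m_1m_2)^{\ast a}=m_1(m_2^{\ast a})+(m_1^{\ast a})m_2$. Crossed module: a homomorphism of AWBs $\mu:\mathsf{M}\to\mathsf{A}$ together with an action of $\mathsf{A}$ on $\mathsf{M}$ such that for all $m,m'\in\mathsf{M}$, $a\in\mathsf{A}$: (CM1) $\mu(m^{\cdot a})=\mu(m)a$, $\mu({}^{a\cdot}m)=a\mu(m)$, $\mu(m^{\ast a})=[\mu(m),a]$, $\mu({}^{a\ast}m)=[a,\mu(m)]$; (CM2) ${}^{\mu(m)\cdot}m'=mm'=m^{\cdot\mu(m')}$ and ${}^{\mu(m)\ast}m'=[m,m']=m^{\ast\mu(m')}$. Let $\mathsf{M},\mathsf{N}$ be AWBs with mutual actions on each other. Call a pair $(u_{\mathsf{M}},u_{\mathsf{N}})\in\mathsf{M}\times\mathsf{N}$ basic if it is one of $(m^{\cdot n},{}^{m\cdot}n)$, $({}^{n\cdot}m,n^{\cdot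 m})$, $(m^{\ast n},{}^{m\ast}n)$, $({}^{n\ast}m,n^{\ast m})$ for some $m\in\mathsf{M}$, $n\in\mathsf{N}$. Compatible actions: the actions are compatible if for every basic pair $(u_{\mathsf{M}},u_{\mathsf{N}})$ and all $m\in\mathsf{M}$, $n\in\mathsf{N}$: $m^{\cdot u_{\mathsf{N}}}=m\,u_{\mathsf{M}}$, $\ m^{\ast u_{\mathsf{N}}}=[m,u_{\mathsf{M}}]$, $\ {}^{u_{\mathsf{M}}\cdot}n=u_{\mathsf{N}}\,n$, $\ {}^{u_{\mathsf{M}}\ast}n=[u_{\mathsf{N}},n]$, and symmetrically $n^{\cdot u_{\mathsf{M}}}=n\,u_{\mathsf{N}}$, $\ n^{\ast u_{\mathsf{M}}}=[n,u_{\mathsf{N}}]$, $\ {}^{u_{\mathsf{N}}\cdot}m=u_{\mathsf{M}}\,m$, $\ {}^{u_{\mathsf{N}}\ast}m=[u_{\mathsf{M}},m]$. Non-abelian tensor product $\mathsf{M}\boxtimes\mathsf{N}$ (for compatible actions): it is the vector space spanned by formal symbols $m\odot n$, $n\odot m$, $m\circledast n$, $n\circledast m$ for $m\in\mathsf{M}$, $n\in\mathsf{N}$ (four formally distinct families, also when $\mathsf{M}$ and $\mathsf{N}$ have elements in common), modulo the following relations, for all $\lambda\in\mathbb{K}$ and all elements, where $\star$ stands for either of $\odot$, $\circledast$: (1) $\lambda(m\star n)=(\lambda m)\star n=m\star(\lambda n)$, $(m+m')\star n=m\star n+m'\star n$, $m\star(n+n')=m\star n+m\star n'$; (2) $u_{\mathsf{M}}\star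 v_{\mathsf{N}}=u_{\mathsf{N}}\star v_{\mathsf{M}}$ for all basic pairs $(u_{\mathsf{M}},u_{\mathsf{N}})$, $(v_{\mathsf{M}},v_{\mathsf{N}})$; (3) $(m_1m_2)\odot n=m_1\odot({}^{m_2\cdot}n)$; $\ n\odot(m_1m_2)=(n^{\cdot m_1})\odot m_2$; $\ (m_1m_2)\circledast n=m_1\odot({}^{m_2\ast}n)+({}^{m_1\ast}n)\odot m_2$; $\ ({}^{m_1\cdot}n)\circledast m_2=m_1\odot(n^{\ast m_2})+[m_1,m_2]\odot n$; $\ (n^{\cdot m_1})\circledast m_2=(n^{\ast m_2})\odot m_1+n\odot[m_1,m_2]$; $\ ({}^{m_1\cdot}n)\odot m_2=m_1\odot(n^{\cdot m_2})$; (4) all relations obtained from (1) and (3) by exchanging the roles of elements of $\mathsf{M}$ and $\mathsf{N}$. With $(g_{\mathsf{M}},g_{\mathsf{N}})$ the (basic) pair associated to a generator $g$ as in the claim, the AWB structure on $\mathsf{M}\boxtimes\mathsf{N}$ is given on generators by $g\,h=g_{\mathsf{M}}\odot h_{\mathsf{N}}$ and $[g,h]=g_{\mathsf{M}}\circledast h_{\mathsf{N}}$. *)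

theory Defs
  imports "HOL-Algebra.Module" "HOL-Algebra.QuotRing"
begin

section \<open>Algebras with bracket\<close>

text \<open>As for every \<^const>\<open>module\<close> record, the field \<open>one\<close> carries no meaning:
  algebras with bracket need not be unital.\<close>

record ('k, 'a) awb = "('k, 'a) module" +
  bracket :: "'a \<Rightarrow> 'a \<Rightarrow> 'a"

definition bilinear_map ::
  "('k, 'p) ring_scheme \<Rightarrow> ('k, 'a, 'q) module_scheme \<Rightarrow> ('k, 'b, 'r) module_scheme \<Rightarrow>
   ('k, 'c, 's) module_scheme \<Rightarrow> ('a \<Rightarrow> 'b \<Rightarrow> 'c) \<Rightarrow> bool" where
  "bilinear_map K A B C f \<longleftrightarrow>
     (\<forall>a\<in>carrier A. \<forall>b\<in>carrier B. f a b \<in> carrier C) \<and>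
     (\<forall>a\<in>carrier A. \<forall>a'\<in>carrier A. \<forall>b\<in>carrier B.
        f (a \<oplus>\<^bsub>A\<^esub> a') b = f a b \<oplus>\<^bsub>C\<^esub> f a' b) \<and>
     (\<forall>a\<in>carrier A. \<forall>b\<in>carrier B. \<forall>b'\<in>carrier B.
        f a (b \<oplus>\<^bsub>B\<^esub> b') = f a b \<oplus>\<^bsub>C\<^esub> f a b') \<and>
     (\<forall>k\<in>carrier K. \<forall>a\<in>carrier A. \<forall>b\<in>carrier B.
        f (k \<odot>\<^bsub>A\<^esub> a) b = k \<odot>\<^bsub>C\<^esub> f a b \<and> f a (k \<odot>\<^bsub>B\<^esub> b) = k \<odot>\<^bsub>C\<^esub> f a b)"

locale awb = K?: field K + module K A
  for K :: "('k, 'p) ring_scheme" (structure) and A :: "('k, 'a, 'q) awb_scheme" (structure) +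
  assumes mult_bilinear: "bilinear_map K A A A (\<otimes>\<^bsub>A\<^esub>)"
    and mult_assoc: "\<lbrakk>a \<in> carrier A; b \<in> carrier A; c \<in> carrier A\<rbrakk> \<Longrightarrow>
      (a \<otimes>\<^bsub>A\<^esub> b) \<otimes>\<^bsub>A\<^esub> c = a \<otimes>\<^bsub>A\<^esub> (b \<otimes>\<^bsub>A\<^esub> c)"
    and bracket_bilinear: "bilinear_map K A A A (bracket A)"
    and bracket_mult: "\<lbrakk>a \<in> carrier A; b \<in> carrier A; c \<in> carrier A\<rbrakk> \<Longrightarrow>
      bracket A (a \<otimes>\<^bsub>A\<^esub> b) c = bracket A a c \<otimes>\<^bsub>A\<^esub> b \<oplus>\<^bsub>A\<^esub> a \<otimes>\<^bsub>A\<^esub> bracket A b c"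

locale awb_hom = A: awb K A + B: awb K B for K and A and B +
  fixes f
  assumes hom_closed: "a \<in> carrier A \<Longrightarrow> f a \<in> carrier B"
    and hom_add: "\<lbrakk>a \<in> carrier A; b \<in> carrier A\<rbrakk> \<Longrightarrow> f (a \<oplus>\<^bsub>A\<^esub> b) = f a \<oplus>\<^bsub>B\<^esub> f b"
    and hom_smult: "\<lbrakk>k \<in> carrier K; a \<in> carrier A\<rbrakk> \<Longrightarrow> f (k \<odot>\<^bsub>A\<^esub> a) = k \<odot>\<^bsub>B\<^esub> f a"
    and hom_mult: "\<lbrakk>a \<in> carrier A; b \<in> carrier A\<rbrakk> \<Longrightarrow> f (a \<otimes>\<^bsub>A\<^esub> b) = f a \<otimes>\<^bsub>B\<^esub> f b"
    and hom_bracket: "\<lbrakk>a \<in> carrier A; b \<in> carrier A\<rbrakk> \<Longrightarrow>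
      f (bracket A a b) = bracket B (f a) (f b)"


section \<open>Actions and crossed modules\<close>

text \<open>The components \<open>ldot \<rho> a m\<close>, \<open>rdot \<rho> m a\<close>, \<open>lstar \<rho> a m\<close>, \<open>rstar \<rho> m a\<close> stand for
  \<open>\<^sup>a\<^sup>\<cdot>m\<close>, \<open>m\<^sup>\<cdot>\<^sup>a\<close>, \<open>\<^sup>a\<^sup>*m\<close>, \<open>m\<^sup>*\<^sup>a\<close>: the arguments appear in the order in which they are written.\<close>

record ('a, 'm) awb_act =
  ldot :: "'a \<Rightarrow> 'm \<Rightarrow> 'm"
  rdot :: "'m \<Rightarrow> 'a \<Rightarrow> 'm"
  lstar :: "'a \<Rightarrow> 'm \<Rightarrow> 'm"
  rstar :: "'m \<Rightarrow> 'a \<Rightarrow> 'm"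

locale awb_action = A: awb K A + M: awb K M
  for K :: "('k, 'p) ring_scheme" and A :: "('k, 'a, 'q) awb_scheme" and M :: "('k, 'm, 'r) awb_scheme" +
  fixes \<rho> :: "('a, 'm) awb_act"
  assumes ldot_bilinear: "bilinear_map K A M M (ldot \<rho>)"
    and rdot_bilinear: "bilinear_map K M A M (rdot \<rho>)"
    and lstar_bilinear: "bilinear_map K A M M (lstar \<rho>)"
    and rstar_bilinear: "bilinear_map K M A M (rstar \<rho>)"
    and ldot_mult: "\<lbrakk>a1 \<in> carrier A; a2 \<in> carrier A; m \<in> carrier M\<rbrakk> \<Longrightarrow>
      ldot \<rho> (a1 \<otimes>\<^bsub>A\<^esub> a2) m = ldot \<rho> a1 (ldot \<rho> a2 m)"
    and rdot_mult: "\<lbrakk>a1 \<in> carrier A; a2 \<in> carrier A; m \<in> carrier M\<rbrakk> \<Longrightarrow>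
      rdot \<rho> m (a1 \<otimes>\<^bsub>A\<^esub> a2) = rdot \<rho> (rdot \<rho> m a1) a2"
    and rdot_ldot: "\<lbrakk>a1 \<in> carrier A; a2 \<in> carrier A; m \<in> carrier M\<rbrakk> \<Longrightarrow>
      rdot \<rho> (ldot \<rho> a1 m) a2 = ldot \<rho> a1 (rdot \<rho> m a2)"
    and rstar_ldot: "\<lbrakk>a1 \<in> carrier A; a2 \<in> carrier A; m \<in> carrier M\<rbrakk> \<Longrightarrow>
      rstar \<rho> (ldot \<rho> a1 m) a2 = ldot \<rho> a1 (rstar \<rho> m a2) \<oplus>\<^bsub>M\<^esub> ldot \<rho> (bracket A a1 a2) m"
    and rstar_rdot: "\<lbrakk>a1 \<in> carrier A; a2 \<in> carrier A; m \<in> carrier M\<rbrakk> \<Longrightarrow>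
      rstar \<rho> (rdot \<rho> m a1) a2 = rdot \<rho> (rstar \<rho> m a2) a1 \<oplus>\<^bsub>M\<^esub> rdot \<rho> m (bracket A a1 a2)"
    and lstar_mult: "\<lbrakk>a1 \<in> carrier A; a2 \<in> carrier A; m \<in> carrier M\<rbrakk> \<Longrightarrow>
      lstar \<rho> (a1 \<otimes>\<^bsub>A\<^esub> a2) m = ldot \<rho> a1 (lstar \<rho> a2 m) \<oplus>\<^bsub>M\<^esub> rdot \<rho> (lstar \<rho> a1 m) a2"
    and mult_rdot: "\<lbrakk>a \<in> carrier A; m1 \<in> carrier M; m2 \<in> carrier M\<rbrakk> \<Longrightarrow>
      rdot \<rho> (m1 \<otimes>\<^bsub>M\<^esub> m2) a = m1 \<otimes>\<^bsub>M\<^esub> rdot \<rho> m2 a"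
    and mult_ldot: "\<lbrakk>a \<in> carrier A; m1 \<in> carrier M; m2 \<in> carrier M\<rbrakk> \<Longrightarrow>
      ldot \<rho> a (m1 \<otimes>\<^bsub>M\<^esub> m2) = ldot \<rho> a m1 \<otimes>\<^bsub>M\<^esub> m2"
    and mult_rdot_ldot: "\<lbrakk>a \<in> carrier A; m1 \<in> carrier M; m2 \<in> carrier M\<rbrakk> \<Longrightarrow>
      rdot \<rho> m1 a \<otimes>\<^bsub>M\<^esub> m2 = m1 \<otimes>\<^bsub>M\<^esub> ldot \<rho> a m2"
    and bracket_rdot: "\<lbrakk>a \<in> carrier A; m1 \<in> carrier M; m2 \<in> carrier M\<rbrakk> \<Longrightarrow>
      bracket M (rdot \<rho> m1 a) m2 = m1 \<otimes>\<^bsub>M\<^esub> lstar \<rho> a m2 \<oplus>\<^bsub>M\<^esub> rdot \<rho> (bracket M m1 m2) a"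
    and bracket_ldot: "\<lbrakk>a \<in> carrier A; m1 \<in> carrier M; m2 \<in> carrier M\<rbrakk> \<Longrightarrow>
      bracket M (ldot \<rho> a m1) m2 = ldot \<rho> a (bracket M m1 m2) \<oplus>\<^bsub>M\<^esub> lstar \<rho> a m2 \<otimes>\<^bsub>M\<^esub> m1"
    and mult_rstar: "\<lbrakk>a \<in> carrier A; m1 \<in> carrier M; m2 \<in> carrier M\<rbrakk> \<Longrightarrow>
      rstar \<rho> (m1 \<otimes>\<^bsub>M\<^esub> m2) a = m1 \<otimes>\<^bsub>M\<^esub> rstar \<rho> m2 a \<oplus>\<^bsub>M\<^esub> rstar \<rho> m1 a \<otimes>\<^bsub>M\<^esub> m2"

locale awb_crossed_module = awb_hom K M A \<mu> + awb_action K A M \<rho> for K and M and A and \<mu> and \<rho> +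
  assumes CM1_dot: "\<lbrakk>m \<in> carrier M; a \<in> carrier A\<rbrakk> \<Longrightarrow>
      \<mu> (rdot \<rho> m a) = \<mu> m \<otimes>\<^bsub>A\<^esub> a \<and> \<mu> (ldot \<rho> a m) = a \<otimes>\<^bsub>A\<^esub> \<mu> m"
    and CM1_star: "\<lbrakk>m \<in> carrier M; a \<in> carrier A\<rbrakk> \<Longrightarrow>
      \<mu> (rstar \<rho> m a) = bracket A (\<mu> m) a \<and> \<mu> (lstar \<rho> a m) = bracket A a (\<mu> m)"
    and CM2_dot: "\<lbrakk>m \<in> carrier M; m' \<in> carrier M\<rbrakk> \<Longrightarrow>
      ldot \<rho> (\<mu> m) m' = m \<otimes>\<^bsub>M\<^esub> m' \<and> m \<otimes>\<^bsub>M\<^esub> m' = rdot \<rho> m (\<mu> m')"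
    and CM2_star: "\<lbrakk>m \<in> carrier M; m' \<in> carrier M\<rbrakk> \<Longrightarrow>
      lstar \<rho> (\<mu> m) m' = bracket M m m' \<and> bracket M m m' = rstar \<rho> m (\<mu> m')"


section \<open>Generators and compatible actions\<close>

text \<open>From here on \<open>\<alpha>\<close> is the action of \<open>M\<close> on \<open>N\<close> and \<open>\<beta>\<close> that of \<open>N\<close> on \<open>M\<close>. The four
  constructors stand for \<open>m \<odot> n\<close>, \<open>n \<odot> m\<close>, \<open>m \<circledast> n\<close>, \<open>n \<circledast> m\<close>.\<close>

datatype ('m, 'n) tgen = Dot_MN 'm 'n | Dot_NM 'n 'm | Star_MN 'm 'n | Star_NM 'n 'm

definition tgens :: "('k, 'm, 'y) awb_scheme \<Rightarrow> ('k, 'n, 'z) awb_scheme \<Rightarrow> ('m, 'n) tgen set" where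
  "tgens M N = (\<Union>m\<in>carrier M. \<Union>n\<in>carrier N. {Dot_MN m n, Dot_NM n m, Star_MN m n, Star_NM n m})"

fun tpair :: "('m, 'n) awb_act \<Rightarrow> ('n, 'm) awb_act \<Rightarrow> ('m, 'n) tgen \<Rightarrow> 'm \<times> 'n" where
  "tpair \<alpha> \<beta> (Dot_MN m n) = (rdot \<beta> m n, ldot \<alpha> m n)"
| "tpair \<alpha> \<beta> (Dot_NM n m) = (ldot \<beta> n m, rdot \<alpha> n m)"
| "tpair \<alpha> \<beta> (Star_MN m n) = (rstar \<beta> m n, lstar \<alpha> m n)"
| "tpair \<alpha> \<beta> (Star_NM n m) = (lstar \<beta> n m, rstar \<alpha> n m)"

definition basic_pairs where
  "basic_pairs M N \<alpha> \<beta> = tpair \<alpha> \<beta> ` tgens M N"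

definition compatible_actions ::
  "('k, 'm, 'y) awb_scheme \<Rightarrow> ('k, 'n, 'z) awb_scheme \<Rightarrow>
   ('m, 'n) awb_act \<Rightarrow> ('n, 'm) awb_act \<Rightarrow> bool" where
  "compatible_actions M N \<alpha> \<beta> \<longleftrightarrow>
     (\<forall>(uM, uN)\<in>basic_pairs M N \<alpha> \<beta>. \<forall>m\<in>carrier M. \<forall>n\<in>carrier N.
        rdot \<beta> m uN = m \<otimes>\<^bsub>M\<^esub> uM \<and>
        rstar \<beta> m uN = bracket M m uM \<and>
        ldot \<alpha> uM n = uN \<otimes>\<^bsub>N\<^esub> n \<and>
        lstar \<alpha> uM n = bracket N uN n \<and>
        rdot \<alpha> n uM = n \<otimes>\<^bsub>N\<^esub> uN \<and>
        rstar \<alpha> n uM = bracket N n uN \<and>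
        ldot \<beta> uN m = uM \<otimes>\<^bsub>M\<^esub> m \<and>
        lstar \<beta> uN m = bracket M uM m)"


section \<open>Vector spaces given by generators and relations\<close>

definition free_vs :: "('k, 'x) ring_scheme \<Rightarrow> 'g set \<Rightarrow> ('k, 'g \<Rightarrow> 'k) module" where
  "free_vs K S =
     \<lparr>carrier = {x. (\<forall>g. x g \<in> carrier K) \<and> finite {g. x g \<noteq> \<zero>\<^bsub>K\<^esub>} \<and> {g. x g \<noteq> \<zero>\<^bsub>K\<^esub>} \<subseteq> S},
      monoid.mult = (\<lambda>x y. undefined), one = undefined,
      ring.zero = (\<lambda>g. \<zero>\<^bsub>K\<^esub>), add = (\<lambda>x y g. x g \<oplus>\<^bsub>K\<^esub> y g),
      smult = (\<lambda>k x g. k \<otimes>\<^bsub>K\<^esub> x g)\<rparr>"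

definition free_gen :: "('k, 'x) ring_scheme \<Rightarrow> 'g \<Rightarrow> 'g \<Rightarrow> 'k" where
  "free_gen K g = (\<lambda>h. if h = g then \<one>\<^bsub>K\<^esub> else \<zero>\<^bsub>K\<^esub>)"

definition vs_span :: "('k, 'x) ring_scheme \<Rightarrow> ('k, 'v, 'y) module_scheme \<Rightarrow> 'v set \<Rightarrow> 'v set" where
  "vs_span K V S = \<Inter>{H. submodule H K V \<and> S \<subseteq> H}"

text \<open>The bilinear extension to \<open>free_vs K S\<close> of a map on pairs of generators.\<close>

definition bilinear_ext ::
  "('k, 'x) ring_scheme \<Rightarrow> ('k, 'v, 'y) module_scheme \<Rightarrow> ('g \<Rightarrow> 'g \<Rightarrow> 'v) \<Rightarrow>
   ('g \<Rightarrow> 'k) \<Rightarrow> ('g \<Rightarrow> 'k) \<Rightarrow> 'v" where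
  "bilinear_ext K V f x y =
     (\<Oplus>\<^bsub>V\<^esub>g\<in>{g. x g \<noteq> \<zero>\<^bsub>K\<^esub>}. \<Oplus>\<^bsub>V\<^esub>h\<in>{h. y h \<noteq> \<zero>\<^bsub>K\<^esub>}. (x g \<otimes>\<^bsub>K\<^esub> y h) \<odot>\<^bsub>V\<^esub> f g h)"


section \<open>The non-abelian tensor product\<close>

text \<open>Relations are pairs of a left and a right hand side in a vector space \<open>F\<close>. The two
  following sets are stated for algebras \<open>A\<close>, \<open>B\<close> in arbitrary roles, with \<open>\<gamma>\<close> the action of
  \<open>A\<close> on \<open>B\<close>, and \<open>dAB a b\<close>, \<open>dBA b a\<close>, \<open>sAB a b\<close>, \<open>sBA b a\<close> the symbols \<open>a \<odot> b\<close>, \<open>b \<odot> a\<close>,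
  \<open>a \<circledast> b\<close>, \<open>b \<circledast> a\<close>; both are used for \<open>(M, N)\<close> as well as for \<open>(N, M)\<close>.\<close>

definition bilinear_rels ::
  "('k, 'x) ring_scheme \<Rightarrow> ('k, 'v, 'w) module_scheme \<Rightarrow> ('k, 'a, 'y) awb_scheme \<Rightarrow>
   ('k, 'b, 'z) awb_scheme \<Rightarrow> ('a \<Rightarrow> 'b \<Rightarrow> 'v) \<Rightarrow> ('v \<times> 'v) set" where
  "bilinear_rels K F A B s =
     {(k \<odot>\<^bsub>F\<^esub> s a b, s (k \<odot>\<^bsub>A\<^esub> a) b) | k a b. k \<in> carrier K \<and> a \<in> carrier A \<and> b \<in> carrier B} \<union>
     {(k \<odot>\<^bsub>F\<^esub> s a b, s a (k \<odot>\<^bsub>B\<^esub> b)) | k a b. k \<in> carrier K \<and> a \<in> carrier A \<and> b \<in> carrier B} \<union>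
     {(s (a \<oplus>\<^bsub>A\<^esub> a') b, s a b \<oplus>\<^bsub>F\<^esub> s a' b) | a a' b.
        a \<in> carrier A \<and> a' \<in> carrier A \<and> b \<in> carrier B} \<union>
     {(s a (b \<oplus>\<^bsub>B\<^esub> b'), s a b \<oplus>\<^bsub>F\<^esub> s a b') | a b b'.
        a \<in> carrier A \<and> b \<in> carrier B \<and> b' \<in> carrier B}"

definition action_rels ::
  "('k, 'v, 'w) module_scheme \<Rightarrow> ('k, 'a, 'y) awb_scheme \<Rightarrow> ('k, 'b, 'z) awb_scheme \<Rightarrow>
   ('a, 'b) awb_act \<Rightarrow> ('a \<Rightarrow> 'b \<Rightarrow> 'v) \<Rightarrow> ('b \<Rightarrow> 'a \<Rightarrow> 'v) \<Rightarrow> ('a \<Rightarrow> 'b \<Rightarrow> 'v) \<Rightarrow> ('b \<Rightarrow> 'a \<Rightarrow> 'v) \<Rightarrow>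
   ('v \<times> 'v) set" where
  "action_rels F A B \<gamma> dAB dBA sAB sBA =
     (\<Union>a1\<in>carrier A. \<Union>a2\<in>carrier A. \<Union>b\<in>carrier B.
       {(dAB (a1 \<otimes>\<^bsub>A\<^esub> a2) b, dAB a1 (ldot \<gamma> a2 b)),
        (dBA b (a1 \<otimes>\<^bsub>A\<^esub> a2), dBA (rdot \<gamma> b a1) a2),
        (sAB (a1 \<otimes>\<^bsub>A\<^esub> a2) b, dAB a1 (lstar \<gamma> a2 b) \<oplus>\<^bsub>F\<^esub> dBA (lstar \<gamma> a1 b) a2),
        (sBA (ldot \<gamma> a1 b) a2, dAB a1 (rstar \<gamma> b a2) \<oplus>\<^bsub>F\<^esub> dAB (bracket A a1 a2) b),
        (sBA (rdot \<gamma> b a1) a2, dBA (rstar \<gamma> b a2) a1 \<oplus>\<^bsub>F\<^esub> dBA b (bracket A a1 a2)),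
        (dBA (ldot \<gamma> a1 b) a2, dAB a1 (rdot \<gamma> b a2))})"

definition tensor_rels ::
  "('k, 'x) ring_scheme \<Rightarrow> ('k, 'm, 'y) awb_scheme \<Rightarrow> ('k, 'n, 'z) awb_scheme \<Rightarrow>
   ('m, 'n) awb_act \<Rightarrow> ('n, 'm) awb_act \<Rightarrow> ((('m, 'n) tgen \<Rightarrow> 'k) \<times> (('m, 'n) tgen \<Rightarrow> 'k)) set" where
  "tensor_rels K M N \<alpha> \<beta> =
     (let F = free_vs K (tgens M N);
          dMN = (\<lambda>m n. free_gen K (Dot_MN m n)); dNM = (\<lambda>n m. free_gen K (Dot_NM n m));
          sMN = (\<lambda>m n. free_gen K (Star_MN m n)); sNM = (\<lambda>n m. free_gen K (Star_NM n m))
      in bilinear_rels K F M N dMN \<union> bilinear_rels K F M N sMN \<union>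
         bilinear_rels K F N M dNM \<union> bilinear_rels K F N M sNM \<union>
         (\<Union>(uM, uN)\<in>basic_pairs M N \<alpha> \<beta>. \<Union>(vM, vN)\<in>basic_pairs M N \<alpha> \<beta>.
            {(dMN uM vN, dNM uN vM), (sMN uM vN, sNM uN vM)}) \<union>
         action_rels F M N \<alpha> dMN dNM sMN sNM \<union>
         action_rels F N M \<beta> dNM dMN sNM sMN)"

definition tensor_kernel ::
  "('k, 'x) ring_scheme \<Rightarrow> ('k, 'm, 'y) awb_scheme \<Rightarrow> ('k, 'n, 'z) awb_scheme \<Rightarrow>
   ('m, 'n) awb_act \<Rightarrow> ('n, 'm) awb_act \<Rightarrow> (('m, 'n) tgen \<Rightarrow> 'k) set" where
  "tensor_kernel K M N \<alpha> \<beta> =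
     (let F = free_vs K (tgens M N)
      in vs_span K F {l \<ominus>\<^bsub>F\<^esub> r | l r. (l, r) \<in> tensor_rels K M N \<alpha> \<beta>})"

definition tclass ::
  "('k, 'x) ring_scheme \<Rightarrow> ('k, 'm, 'y) awb_scheme \<Rightarrow> ('k, 'n, 'z) awb_scheme \<Rightarrow>
   ('m, 'n) awb_act \<Rightarrow> ('n, 'm) awb_act \<Rightarrow> ('m, 'n) tgen \<Rightarrow> (('m, 'n) tgen \<Rightarrow> 'k) set" where
  "tclass K M N \<alpha> \<beta> g = tensor_kernel K M N \<alpha> \<beta> +>\<^bsub>free_vs K (tgens M N)\<^esub> free_gen K g"

text \<open>The operations on residue classes are the unions of the results over all representatives, as
  in \<^const>\<open>rcoset_mult\<close>; such a union is again a residue class exactly when the operation does not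
  depend on the choice of representatives.\<close>

definition nonab_tensor ::
  "('k, 'x) ring_scheme \<Rightarrow> ('k, 'm, 'y) awb_scheme \<Rightarrow> ('k, 'n, 'z) awb_scheme \<Rightarrow>
   ('m, 'n) awb_act \<Rightarrow> ('n, 'm) awb_act \<Rightarrow> ('k, (('m, 'n) tgen \<Rightarrow> 'k) set) awb" where
  "nonab_tensor K M N \<alpha> \<beta> =
     (let F = free_vs K (tgens M N);
          R = tensor_kernel K M N \<alpha> \<beta>;
          gM = (\<lambda>g. fst (tpair \<alpha> \<beta> g)); gN = (\<lambda>g. snd (tpair \<alpha> \<beta> g));
          prd = bilinear_ext K F (\<lambda>g h. free_gen K (Dot_MN (gM g) (gN h)));
          brk = bilinear_ext K F (\<lambda>g h. free_gen K (Star_MN (gM g) (gN h)))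
      in \<lparr>carrier = a_rcosets\<^bsub>F\<^esub> R,
          monoid.mult = (\<lambda>U V. \<Union>x\<in>U. \<Union>y\<in>V. R +>\<^bsub>F\<^esub> prd x y),
          one = undefined,
          ring.zero = R,
          add = set_add F,
          smult = (\<lambda>k U. \<Union>x\<in>U. R +>\<^bsub>F\<^esub> (k \<odot>\<^bsub>F\<^esub> x)),
          bracket = (\<lambda>U V. \<Union>x\<in>U. \<Union>y\<in>V. R +>\<^bsub>F\<^esub> brk x y)\<rparr>)"

end

theory Submission
  imports Defs
begin

text \<open>Write \<open>T\<close> for the tensor product. Everything rests on two observations about the maps
  \<open>\<psi>M\<close> and \<open>\<psi>N\<close>, which are defined on the free vector space by \<open>g \<mapsto> g\<^sub>M\<close> and \<open>g \<mapsto> g\<^sub>N\<close>.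

  First, both respect the defining relations and hence descend to \<open>T\<close>. A relation holds in \<open>M\<close>
  for the images \<open>g\<^sub>M\<close> because compatibility turns it into an axiom of the action of \<open>N\<close> on \<open>M\<close>:
  for example \<open>(m\<^sub>1m\<^sub>2) \<odot> n = m\<^sub>1 \<odot> (\<^sup>m\<^sup>2\<^sup>\<cdot>n)\<close> becomes \<open>(m\<^sub>1m\<^sub>2)\<^sup>\<cdot>\<^sup>n = m\<^sub>1(m\<^sub>2\<^sup>\<cdot>\<^sup>n)\<close>, since acting by
  \<open>\<^sup>m\<^sup>2\<^sup>\<cdot>n\<close> is multiplying by \<open>m\<^sub>2\<^sup>\<cdot>\<^sup>n\<close> (\<open>relations_fst_tpair\<close>). The relations are symmetric in \<open>M\<close>
  and \<open>N\<close> (\<open>tensor_relations_swap\<close>), so this settles \<open>N\<close> as well.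

  Secondly, product, bracket and both actions factor through \<open>\<psi>M\<close> and \<open>\<psi>N\<close>: one has
  \<open>t s = \<psi>M t \<odot> \<psi>N s\<close>, \<open>[t, s] = \<psi>M t \<circledast> \<psi>N s\<close>, \<open>\<^sup>m\<^sup>\<cdot>t = m \<odot> \<psi>N t\<close>, and so on, where \<open>\<odot>\<close> and
  \<open>\<circledast>\<close> are bilinear. Hence all operations are well defined and bilinear, and each axiom of an
  algebra with bracket or of an action becomes one of the defining relations, read for elements
  \<open>\<psi>M t\<close> and \<open>\<psi>N t\<close>. Two facts serve to match the two sides, and they also contain the conditions
  on a crossed module. Compatibility
  extends from generators to all of \<open>T\<close>, so that \<open>\<psi>N t\<close> acts on \<open>M\<close> as multiplication by
  \<open>\<psi>M t\<close> (\<open>on_M_psiN\<close>); and the relations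
  \<open>u\<^sub>M \<odot> v\<^sub>N = u\<^sub>N \<odot> v\<^sub>M\<close> between basic pairs extend to \<open>\<psi>M t \<odot> \<psi>N s = \<psi>N t \<odot> \<psi>M s\<close>
  (\<open>balanced\<close>). The latter also makes the formulas for product and bracket symmetric in \<open>M\<close> and
  \<open>N\<close>, so that the crossed module over \<open>N\<close> is the one over \<open>M\<close> with the roles exchanged
  (\<open>swapped_model\<close>).

  The algebraic part is carried out for any module \<open>T\<close> with these properties (locale
  \<open>tensor_model\<close>); linear algebra on generators, relations and cosets then shows that the quotient
  of the free vector space is such a module (\<open>ex_tensor_model\<close>).\<close>


section \<open>Linear maps and spans\<close>

locale linear_map = V: module K V + W: module K W
  for K :: "('k, 'x) ring_scheme" and V :: "('k, 'v, 'y) module_scheme"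
    and W :: "('k, 'w, 'z) module_scheme" +
  fixes f :: "'v \<Rightarrow> 'w"
  assumes map_closed: "x \<in> carrier V \<Longrightarrow> f x \<in> carrier W"
    and map_add: "\<lbrakk>x \<in> carrier V; y \<in> carrier V\<rbrakk> \<Longrightarrow> f (x \<oplus>\<^bsub>V\<^esub> y) = f x \<oplus>\<^bsub>W\<^esub> f y"
    and map_smult: "\<lbrakk>k \<in> carrier K; x \<in> carrier V\<rbrakk> \<Longrightarrow> f (k \<odot>\<^bsub>V\<^esub> x) = k \<odot>\<^bsub>W\<^esub> f x"
begin

lemma map_zero: "f \<zero>\<^bsub>V\<^esub> = \<zero>\<^bsub>W\<^esub>"
proof -
  have "f (\<zero>\<^bsub>K\<^esub> \<odot>\<^bsub>V\<^esub> \<zero>\<^bsub>V\<^esub>) = \<zero>\<^bsub>K\<^esub> \<odot>\<^bsub>W\<^esub> f \<zero>\<^bsub>V\<^esub>"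
    by (rule map_smult) auto
  then show ?thesis by (simp add: map_closed)
qed

lemma map_minus: "x \<in> carrier V \<Longrightarrow> f (\<ominus>\<^bsub>V\<^esub> x) = \<ominus>\<^bsub>W\<^esub> f x"
  using map_smult[of "\<ominus>\<^bsub>K\<^esub> \<one>\<^bsub>K\<^esub>" x] by (simp add: V.smult_l_minus W.smult_l_minus map_closed)

lemma map_diff:
  "\<lbrakk>x \<in> carrier V; y \<in> carrier V\<rbrakk> \<Longrightarrow> f (x \<ominus>\<^bsub>V\<^esub> y) = f x \<ominus>\<^bsub>W\<^esub> f y"
  by (simp add: a_minus_def map_add map_minus)

lemma map_lincomb:
  assumes "finite I" and "\<And>i. i \<in> I \<Longrightarrow> c i \<in> carrier K"
    and "\<And>i. i \<in> I \<Longrightarrow> v i \<in> carrier V"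
  shows "f (\<Oplus>\<^bsub>V\<^esub>i\<in>I. c i \<odot>\<^bsub>V\<^esub> v i) = (\<Oplus>\<^bsub>W\<^esub>i\<in>I. c i \<odot>\<^bsub>W\<^esub> f (v i))"
  using assms
proof (induction I rule: finite_induct)
  case empty
  then show ?case by (simp add: map_zero)
next
  case (insert i I)
  then have "(\<Oplus>\<^bsub>V\<^esub>i\<in>I. c i \<odot>\<^bsub>V\<^esub> v i) \<in> carrier V"
    by (intro V.finsum_closed) auto
  with insert show ?case
    by (simp add: Pi_def map_add map_smult map_closed)
qed

lemma submodule_vimage:
  assumes "submodule H K W"
  shows "submodule {x \<in> carrier V. f x \<in> H} K V"
  using W.submoduleE[OF assms] subgroup.one_closed[OF submodule.axioms(1)[OF assms]]
  by (intro V.submoduleI) (auto simp: map_zero map_add map_minus map_smult)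

end

lemma linear_map_compose:
  assumes "linear_map K U V f" and "linear_map K V W g"
  shows "linear_map K U W (\<lambda>x. g (f x))"
proof -
  interpret f: linear_map K U V f by fact
  interpret g: linear_map K V W g by fact
  show ?thesis
    by unfold_locales
      (auto simp: f.map_closed g.map_closed f.map_add g.map_add f.map_smult g.map_smult)
qed

lemma linear_map_zero:
  assumes "module K V" and "module K W"
  shows "linear_map K V W (\<lambda>x. \<zero>\<^bsub>W\<^esub>)"
proof -
  interpret V: module K V by fact
  interpret W: module K W by fact
  show ?thesis by unfold_locales auto
qed

lemma submodule_equalizer:
  assumes "linear_map K V W f" and "linear_map K V W g"
  shows "submodule {x \<in> carrier V. f x = g x} K V"
proof -
  interpret f: linear_map K V W f by fact
  interpret g: linear_map K V W g by fact
  show ?thesis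
    by (intro f.V.submoduleI) 
      (auto simp: f.map_zero g.map_zero f.map_add g.map_add f.map_minus g.map_minus
        f.map_smult g.map_smult)
qed

lemma vs_span_least: "\<lbrakk>submodule H K V; S \<subseteq> H; x \<in> vs_span K V S\<rbrakk> \<Longrightarrow> x \<in> H"
  by (auto simp: vs_span_def)

lemma vs_span_superset: "S \<subseteq> vs_span K V S"
  by (auto simp: vs_span_def)

lemma submodule_vs_span:
  assumes "module K V" and "S \<subseteq> carrier V"
  shows "submodule (vs_span K V S) K V"
proof -
  interpret V: module K V by fact
  have "vs_span K V S \<subseteq> carrier V"
    using V.carrier_is_submodule assms(2) by (auto simp: vs_span_def)
  then show ?thesis
    by (intro V.submoduleI)
      (auto simp: vs_span_def V.submoduleE submodule.axioms(1)[THEN subgroup.one_closed, simplified])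
qed

text \<open>The maps agree on a submodule, their equalizer, which contains \<open>S\<close> and hence its span.\<close>

lemma linear_map_eq_on_span:
  assumes "linear_map K V W f" and "linear_map K V W g"
    and "S \<subseteq> carrier V" and "\<And>x. x \<in> S \<Longrightarrow> f x = g x" and "x \<in> vs_span K V S"
  shows "f x = g x"
  using vs_span_least[OF submodule_equalizer[OF assms(1,2)] _ assms(5)] assms(3,4) by auto


section \<open>Bilinear maps\<close>

lemma bilinear_mapI:
  assumes "\<And>a b. \<lbrakk>a \<in> carrier A; b \<in> carrier B\<rbrakk> \<Longrightarrow> D a b \<in> carrier C"
    and "\<And>a a' b. \<lbrakk>a \<in> carrier A; a' \<in> carrier A; b \<in> carrier B\<rbrakk> \<Longrightarrow>
      D (a \<oplus>\<^bsub>A\<^esub> a') b = D a b \<oplus>\<^bsub>C\<^esub> D a' b"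
    and "\<And>a b b'. \<lbrakk>a \<in> carrier A; b \<in> carrier B; b' \<in> carrier B\<rbrakk> \<Longrightarrow>
      D a (b \<oplus>\<^bsub>B\<^esub> b') = D a b \<oplus>\<^bsub>C\<^esub> D a b'"
    and "\<And>k a b. \<lbrakk>k \<in> carrier K; a \<in> carrier A; b \<in> carrier B\<rbrakk> \<Longrightarrow>
      D (k \<odot>\<^bsub>A\<^esub> a) b = k \<odot>\<^bsub>C\<^esub> D a b"
    and "\<And>k a b. \<lbrakk>k \<in> carrier K; a \<in> carrier A; b \<in> carrier B\<rbrakk> \<Longrightarrow>
      D a (k \<odot>\<^bsub>B\<^esub> b) = k \<odot>\<^bsub>C\<^esub> D a b"
  shows "bilinear_map K A B C D"
  using assms by (simp add: bilinear_map_def)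

lemma bilinear_mapD:
  assumes "bilinear_map K A B C D"
  shows "\<And>a b. \<lbrakk>a \<in> carrier A; b \<in> carrier B\<rbrakk> \<Longrightarrow> D a b \<in> carrier C"
    and "\<And>a a' b. \<lbrakk>a \<in> carrier A; a' \<in> carrier A; b \<in> carrier B\<rbrakk> \<Longrightarrow>
      D (a \<oplus>\<^bsub>A\<^esub> a') b = D a b \<oplus>\<^bsub>C\<^esub> D a' b"
    and "\<And>a b b'. \<lbrakk>a \<in> carrier A; b \<in> carrier B; b' \<in> carrier B\<rbrakk> \<Longrightarrow>
      D a (b \<oplus>\<^bsub>B\<^esub> b') = D a b \<oplus>\<^bsub>C\<^esub> D a b'"
    and "\<And>k a b. \<lbrakk>k \<in> carrier K; a \<in> carrier A; b \<in> carrier B\<rbrakk> \<Longrightarrow>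
      D (k \<odot>\<^bsub>A\<^esub> a) b = k \<odot>\<^bsub>C\<^esub> D a b"
    and "\<And>k a b. \<lbrakk>k \<in> carrier K; a \<in> carrier A; b \<in> carrier B\<rbrakk> \<Longrightarrow>
      D a (k \<odot>\<^bsub>B\<^esub> b) = k \<odot>\<^bsub>C\<^esub> D a b"
  using assms by (simp_all add: bilinear_map_def)

lemma bilinear_map_left:
  assumes "bilinear_map K A B C D" and "module K A" and "module K C" and "b \<in> carrier B"
  shows "linear_map K A C (\<lambda>a. D a b)"
  using assms by (simp add: linear_map_def linear_map_axioms_def bilinear_mapD[OF assms(1)])

lemma bilinear_map_right:
  assumes "bilinear_map K A B C D" and "module K B" and "module K C" and "a \<in> carrier A"
  shows "linear_map K B C (D a)"
  using assms by (simp add: linear_map_def linear_map_axioms_def bilinear_mapD[OF assms(1)])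

lemma bilinear_map_compose:
  assumes D: "bilinear_map K A B C D" and "linear_map K A' A f" and "linear_map K B' B g"
  shows "bilinear_map K A' B' C (\<lambda>a b. D (f a) (g b))"
proof -
  interpret f: linear_map K A' A f by fact
  interpret g: linear_map K B' B g by fact
  show ?thesis
    by (rule bilinear_mapI)
      (simp_all add: f.map_closed f.map_add f.map_smult g.map_closed g.map_add g.map_smult
        bilinear_mapD[OF D])
qed

lemma linear_map_id: "module K V \<Longrightarrow> linear_map K V V (\<lambda>x. x)"
  by (simp add: linear_map_def linear_map_axioms_def)


section \<open>Free vector spaces\<close>

definition linear_ext ::
  "('k, 'x) ring_scheme \<Rightarrow> ('k, 'v, 'y) module_scheme \<Rightarrow> ('g \<Rightarrow> 'v) \<Rightarrow> ('g \<Rightarrow> 'k) \<Rightarrow> 'v" where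
  "linear_ext K V f x = (\<Oplus>\<^bsub>V\<^esub>g\<in>{g. x g \<noteq> \<zero>\<^bsub>K\<^esub>}. x g \<odot>\<^bsub>V\<^esub> f g)"

lemma module_free_vs:
  fixes K :: "('k, 'x) ring_scheme" and S :: "'g set"
  assumes "cring K"
  shows "module K (free_vs K S)"
proof -
  interpret cring K by fact
  have supp_add: "{g. x g \<oplus>\<^bsub>K\<^esub> y g \<noteq> \<zero>\<^bsub>K\<^esub>} \<subseteq> {g. x g \<noteq> \<zero>\<^bsub>K\<^esub>} \<union> {g. y g \<noteq> \<zero>\<^bsub>K\<^esub>}" for x y :: "'g \<Rightarrow> 'k"
    by auto
  have add_closed: "(\<lambda>g. x g \<oplus>\<^bsub>K\<^esub> y g) \<in> carrier (free_vs K S)"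
    if "x \<in> carrier (free_vs K S)" "y \<in> carrier (free_vs K S)" for x y
    using that supp_add[of x y] by (auto simp: free_vs_def intro: finite_subset)
  have smult_closed: "(\<lambda>g. k \<otimes>\<^bsub>K\<^esub> x g) \<in> carrier (free_vs K S)"
    if "k \<in> carrier K" "x \<in> carrier (free_vs K S)" for k x
  proof -
    have "{g. k \<otimes>\<^bsub>K\<^esub> x g \<noteq> \<zero>\<^bsub>K\<^esub>} \<subseteq> {g. x g \<noteq> \<zero>\<^bsub>K\<^esub>}"
      using that(1) by auto
    with that show ?thesis by (auto simp: free_vs_def intro: finite_subset)
  qed
  have inverse: "\<exists>y\<in>carrier (free_vs K S). y \<oplus>\<^bsub>free_vs K S\<^esub> x = \<zero>\<^bsub>free_vs K S\<^esub>"
    if "x \<in> carrier (free_vs K S)" for x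
    using that smult_closed[of "\<ominus>\<^bsub>K\<^esub> \<one>\<^bsub>K\<^esub>" x]
    by (intro bexI[of _ "\<lambda>g. \<ominus>\<^bsub>K\<^esub> \<one>\<^bsub>K\<^esub> \<otimes>\<^bsub>K\<^esub> x g"]) (auto simp: free_vs_def l_minus l_neg)
  have "abelian_group (free_vs K S)"
    using add_closed inverse
    by (intro abelian_groupI) (auto simp: free_vs_def a_ac)
  then show ?thesis
    using smult_closed
    by (intro moduleI) (auto simp: free_vs_def l_distr r_distr m_assoc assms)
qed

lemma free_vs_simps:
  "\<zero>\<^bsub>free_vs K S\<^esub> = (\<lambda>g. \<zero>\<^bsub>K\<^esub>)"
  "x \<oplus>\<^bsub>free_vs K S\<^esub> y = (\<lambda>g. x g \<oplus>\<^bsub>K\<^esub> y g)"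
  "k \<odot>\<^bsub>free_vs K S\<^esub> x = (\<lambda>g. k \<otimes>\<^bsub>K\<^esub> x g)"
  by (simp_all add: free_vs_def)

lemma free_gen_closed:
  assumes "cring K" and "g \<in> S"
  shows "free_gen K g \<in> carrier (free_vs K S)"
proof -
  interpret cring K by fact
  have "{h. free_gen K g h \<noteq> \<zero>\<^bsub>K\<^esub>} \<subseteq> {g}" by (auto simp: free_gen_def)
  with \<open>g \<in> S\<close> show ?thesis
    by (auto simp: free_vs_def free_gen_def intro: finite_subset)
qed

lemma free_vs_span:
  assumes K: "cring K"
  shows "vs_span K (free_vs K S) (free_gen K ` S) = carrier (free_vs K S)"
proof
  interpret cring K by fact
  interpret F: module K "free_vs K S" by (rule module_free_vs) fact
  show "vs_span K (free_vs K S) (free_gen K ` S) \<subseteq> carrier (free_vs K S)"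
    by (rule subsetI, rule vs_span_least[OF F.carrier_is_submodule])
      (auto intro: free_gen_closed[OF K])
  show "carrier (free_vs K S) \<subseteq> vs_span K (free_vs K S) (free_gen K ` S)"
  proof
    let ?H = "vs_span K (free_vs K S) (free_gen K ` S)"
    interpret H: submodule ?H K "free_vs K S"
      using free_gen_closed[OF K] by (intro submodule_vs_span[OF F.module_axioms]) auto
    fix x assume x: "x \<in> carrier (free_vs K S)"
    \<comment> \<open>The finite support is emptied one generator at a time.\<close>
    have "y \<in> ?H" if "finite A" "A \<subseteq> S" "y \<in> carrier (free_vs K S)" "{g. y g \<noteq> \<zero>\<^bsub>K\<^esub>} \<subseteq> A" for A y
      using that
    proof (induction A arbitrary: y rule: finite_induct)
      case empty
      then have "y = \<zero>\<^bsub>free_vs K S\<^esub>" by (auto simp: free_vs_simps)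
      then show ?case using H.one_closed by simp
    next
      case (insert a A)
      let ?y = "y(a := \<zero>\<^bsub>K\<^esub>)"
      have ya: "y a \<in> carrier K" using insert.prems by (simp add: free_vs_def)
      have y': "?y \<in> carrier (free_vs K S)"
        using insert.prems insert.hyps(1)
        by (auto simp: free_vs_def intro: finite_subset[of _ "insert a A"])
      have "?y \<in> ?H" using insert.prems by (intro insert.IH[OF _ y']) auto
      moreover have "y a \<odot>\<^bsub>free_vs K S\<^esub> free_gen K a \<in> ?H"
        using ya insert.prems by (intro H.smult_closed subsetD[OF vs_span_superset]) auto
      moreover have "y = ?y \<oplus>\<^bsub>free_vs K S\<^esub> (y a \<odot>\<^bsub>free_vs K S\<^esub> free_gen K a)"
        using insert.prems ya by (auto simp: free_vs_simps free_gen_def free_vs_def fun_eq_iff)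
      ultimately show ?case using H.m_closed by fastforce
    qed
    then show "x \<in> ?H" using x by (auto simp: free_vs_def)
  qed
qed


text \<open>The sum defining \<open>linear_ext\<close> runs over the support, which varies with the argument; additivity
  needs one common index set for two vectors and their sum.\<close>

lemma linear_ext_superset:
  assumes "module K V" and "finite A" and "{g. x g \<noteq> \<zero>\<^bsub>K\<^esub>} \<subseteq> A"
    and "\<And>g. x g \<in> carrier K" and "\<And>g. g \<in> A \<Longrightarrow> f g \<in> carrier V"
  shows "linear_ext K V f x = (\<Oplus>\<^bsub>V\<^esub>g\<in>A. x g \<odot>\<^bsub>V\<^esub> f g)"
proof -
  interpret V: module K V by fact
  show ?thesis
    unfolding linear_ext_def
    by (rule V.add.finprod_mono_neutral_cong_left) (use assms in auto)
qed

lemma linear_map_linear_ext: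
  assumes "module K V" and f: "\<And>g. g \<in> S \<Longrightarrow> f g \<in> carrier V"
  shows "linear_map K (free_vs K S) V (linear_ext K V f)"
proof -
  interpret V: module K V by fact
  interpret F: module K "free_vs K S" by (rule module_free_vs) unfold_locales
  have sum: "linear_ext K V f x = (\<Oplus>\<^bsub>V\<^esub>g\<in>A. x g \<odot>\<^bsub>V\<^esub> f g)"
    if "x \<in> carrier (free_vs K S)" "{g. x g \<noteq> \<zero>\<^bsub>K\<^esub>} \<subseteq> A" "finite A" "A \<subseteq> S" for x A
    using that by (intro linear_ext_superset assms) (auto simp: free_vs_def)
  show ?thesis
  proof
    fix x assume x: "x \<in> carrier (free_vs K S)"
    then show "linear_ext K V f x \<in> carrier V"
      unfolding linear_ext_def using f by (intro V.finsum_closed) (auto simp: free_vs_def)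
    fix k assume k: "k \<in> carrier K"
    let ?A = "{g. x g \<noteq> \<zero>\<^bsub>K\<^esub>}"
    have A: "finite ?A" "?A \<subseteq> S" and xK: "\<And>g. x g \<in> carrier K"
      using x by (auto simp: free_vs_def)
    have kx: "k \<odot>\<^bsub>free_vs K S\<^esub> x \<in> carrier (free_vs K S)" using k x by simp
    have "linear_ext K V f (k \<odot>\<^bsub>free_vs K S\<^esub> x) = (\<Oplus>\<^bsub>V\<^esub>g\<in>?A. (k \<otimes>\<^bsub>K\<^esub> x g) \<odot>\<^bsub>V\<^esub> f g)"
      by (subst sum[OF kx _ A]) (use k in \<open>auto simp: free_vs_simps\<close>)
    also have "\<dots> = (\<Oplus>\<^bsub>V\<^esub>g\<in>?A. k \<odot>\<^bsub>V\<^esub> (x g \<odot>\<^bsub>V\<^esub> f g))"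
      using A f k xK by (intro V.finsum_cong') (auto simp: V.smult_assoc1 subset_iff)
    also have "\<dots> = k \<odot>\<^bsub>V\<^esub> linear_ext K V f x"
      unfolding linear_ext_def using A f k xK
      by (subst V.finsum_smult_ldistr) (auto simp: subset_iff)
    finally show "linear_ext K V f (k \<odot>\<^bsub>free_vs K S\<^esub> x) = k \<odot>\<^bsub>V\<^esub> linear_ext K V f x" .
  next
    fix x y assume xy: "x \<in> carrier (free_vs K S)" "y \<in> carrier (free_vs K S)"
    let ?A = "{g. x g \<noteq> \<zero>\<^bsub>K\<^esub>} \<union> {g. y g \<noteq> \<zero>\<^bsub>K\<^esub>}"
    have A: "finite ?A" "?A \<subseteq> S" and K: "\<And>g. x g \<in> carrier K" "\<And>g. y g \<in> carrier K"
      using xy by (auto simp: free_vs_def)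
    have "linear_ext K V f (x \<oplus>\<^bsub>free_vs K S\<^esub> y) = (\<Oplus>\<^bsub>V\<^esub>g\<in>?A. (x g \<oplus>\<^bsub>K\<^esub> y g) \<odot>\<^bsub>V\<^esub> f g)"
      by (subst sum[OF F.add.m_closed[OF xy] _ A]) (auto simp: free_vs_simps)
    also have "\<dots> = (\<Oplus>\<^bsub>V\<^esub>g\<in>?A. x g \<odot>\<^bsub>V\<^esub> f g \<oplus>\<^bsub>V\<^esub> y g \<odot>\<^bsub>V\<^esub> f g)"
      using A f K by (intro V.finsum_cong') (auto simp: V.smult_l_distr subset_iff)
    also have "\<dots> = (\<Oplus>\<^bsub>V\<^esub>g\<in>?A. x g \<odot>\<^bsub>V\<^esub> f g) \<oplus>\<^bsub>V\<^esub> (\<Oplus>\<^bsub>V\<^esub>g\<in>?A. y g \<odot>\<^bsub>V\<^esub> f g)"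
      using A f K by (intro V.finsum_addf) (auto simp: subset_iff)
    also have "\<dots> = linear_ext K V f x \<oplus>\<^bsub>V\<^esub> linear_ext K V f y"
      using xy A by (subst (1 2) sum[of _ ?A]) auto
    finally show "linear_ext K V f (x \<oplus>\<^bsub>free_vs K S\<^esub> y) = linear_ext K V f x \<oplus>\<^bsub>V\<^esub> linear_ext K V f y" .
  qed
qed

lemma linear_ext_free_gen:
  assumes "module K V" and "f g \<in> carrier V"
  shows "linear_ext K V f (free_gen K g) = f g"
proof -
  interpret V: module K V by fact
  have "linear_ext K V f (free_gen K g) = (\<Oplus>\<^bsub>V\<^esub>h\<in>{g}. free_gen K g h \<odot>\<^bsub>V\<^esub> f h)"
    using assms by (intro linear_ext_superset) (auto simp: free_gen_def)
  then show ?thesis using assms by (simp add: free_gen_def)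
qed

text \<open>For a linear \<open>q\<close>, a bilinear extension followed by \<open>q\<close> depends on its arguments only through
  their images under two linear maps as soon as this is so on generators. With \<open>q\<close> the projection to
  the tensor product this gives the independence of product and bracket of representatives.\<close>

lemma linear_map_bilinear_ext:
  assumes q: "linear_map K V W q" and D: "bilinear_map K A B W D"
    and "module K A" and "module K B"
    and a: "\<And>g. g \<in> S \<Longrightarrow> a g \<in> carrier A" and b: "\<And>g. g \<in> S \<Longrightarrow> b g \<in> carrier B"
    and f: "\<And>g h. \<lbrakk>g \<in> S; h \<in> S\<rbrakk> \<Longrightarrow> f g h \<in> carrier V"
    and qf: "\<And>g h. \<lbrakk>g \<in> S; h \<in> S\<rbrakk> \<Longrightarrow> q (f g h) = D (a g) (b h)"
    and x: "x \<in> carrier (free_vs K S)" and y: "y \<in> carrier (free_vs K S)"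
  shows "q (bilinear_ext K V f x y) = D (linear_ext K A a x) (linear_ext K B b y)"
proof -
  interpret q: linear_map K V W q by fact
  interpret A: module K A by fact
  interpret B: module K B by fact
  let ?X = "{g. x g \<noteq> \<zero>\<^bsub>K\<^esub>}" and ?Y = "{h. y h \<noteq> \<zero>\<^bsub>K\<^esub>}"
  have X: "finite ?X" "\<And>g. g \<in> ?X \<Longrightarrow> g \<in> S" "\<And>g. x g \<in> carrier K"
    and Y: "finite ?Y" "\<And>h. h \<in> ?Y \<Longrightarrow> h \<in> S" "\<And>h. y h \<in> carrier K"
    using x y by (auto simp: free_vs_def)
  \<comment> \<open>The inner sum, with the coefficient of the outer variable taken out.\<close>
  define u where "u g = (\<Oplus>\<^bsub>V\<^esub>h\<in>?Y. y h \<odot>\<^bsub>V\<^esub> f g h)" for g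
  have u: "u g \<in> carrier V" if "g \<in> ?X" for g
    unfolding u_def using X(2)[OF that] Y f by (intro q.V.finsum_closed) auto
  have "(\<Oplus>\<^bsub>V\<^esub>h\<in>?Y. (x g \<otimes>\<^bsub>K\<^esub> y h) \<odot>\<^bsub>V\<^esub> f g h) = x g \<odot>\<^bsub>V\<^esub> u g" if "g \<in> ?X" for g
  proof -
    have "(\<Oplus>\<^bsub>V\<^esub>h\<in>?Y. (x g \<otimes>\<^bsub>K\<^esub> y h) \<odot>\<^bsub>V\<^esub> f g h) = (\<Oplus>\<^bsub>V\<^esub>h\<in>?Y. x g \<odot>\<^bsub>V\<^esub> (y h \<odot>\<^bsub>V\<^esub> f g h))"
      using X(2)[OF that] X(3) Y f by (intro q.V.finsum_cong') (auto simp: q.V.smult_assoc1)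
    also have "\<dots> = x g \<odot>\<^bsub>V\<^esub> u g"
      unfolding u_def using X(2)[OF that] X(3) Y f
      by (subst q.V.finsum_smult_ldistr) auto
    finally show ?thesis .
  qed
  then have ext: "bilinear_ext K V f x y = (\<Oplus>\<^bsub>V\<^esub>g\<in>?X. x g \<odot>\<^bsub>V\<^esub> u g)"
    unfolding bilinear_ext_def using X u by (intro q.V.finsum_cong') auto
  have bY: "linear_ext K B b y \<in> carrier B"
    unfolding linear_ext_def using Y b by (intro B.finsum_closed) auto
  have qu: "q (u g) = D (a g) (linear_ext K B b y)" if "g \<in> ?X" for g
  proof -
    interpret right: linear_map K B W "D (a g)"
      using bilinear_map_right[OF D B.module_axioms q.W.module_axioms] a X(2)[OF that] by blast
    have "q (u g) = (\<Oplus>\<^bsub>W\<^esub>h\<in>?Y. y h \<odot>\<^bsub>W\<^esub> q (f g h))"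
      unfolding u_def using X(2)[OF that] Y f by (intro q.map_lincomb) auto
    also have "\<dots> = (\<Oplus>\<^bsub>W\<^esub>h\<in>?Y. y h \<odot>\<^bsub>W\<^esub> D (a g) (b h))"
      using X(2)[OF that] Y b qf
      by (intro q.W.finsum_cong') (auto intro!: q.W.smult_closed right.map_closed)
    also have "\<dots> = D (a g) (linear_ext K B b y)"
      unfolding linear_ext_def using Y b by (intro right.map_lincomb[symmetric]) auto
    finally show ?thesis .
  qed
  interpret left: linear_map K A W "\<lambda>a. D a (linear_ext K B b y)"
    by (rule bilinear_map_left[OF D A.module_axioms q.W.module_axioms bY])
  have "q (bilinear_ext K V f x y) = (\<Oplus>\<^bsub>W\<^esub>g\<in>?X. x g \<odot>\<^bsub>W\<^esub> q (u g))"
    unfolding ext using X u by (intro q.map_lincomb) auto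
  also have "\<dots> = (\<Oplus>\<^bsub>W\<^esub>g\<in>?X. x g \<odot>\<^bsub>W\<^esub> D (a g) (linear_ext K B b y))"
    using X a qu
    by (intro q.W.finsum_cong') (auto intro!: q.W.smult_closed left.map_closed)
  also have "\<dots> = D (linear_ext K A a x) (linear_ext K B b y)"
    unfolding linear_ext_def[of K A] using X a by (intro left.map_lincomb[symmetric]) auto
  finally show ?thesis .
qed


section \<open>Quotient spaces\<close>

text \<open>Only carrier, zero, addition and scalar multiplication of \<open>Q\<close> are prescribed, so that \<open>Q\<close> may
  carry a product and a bracket besides.\<close>

locale quotient_space = F: module K F + R: submodule R K F
  for K :: "('k, 'x) ring_scheme" and F :: "('k, 'v, 'y) module_scheme" and R :: "'v set" +
  fixes Q :: "('k, 'v set, 'z) module_scheme"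
  assumes carrier_Q: "carrier Q = a_rcosets\<^bsub>F\<^esub> R"
    and zero_Q: "\<zero>\<^bsub>Q\<^esub> = R"
    and add_Q: "add Q = set_add F"
    and smult_Q: "smult Q = (\<lambda>k U. \<Union>x\<in>U. R +>\<^bsub>F\<^esub> (k \<odot>\<^bsub>F\<^esub> x))"
begin

sublocale abelian_subgroup R F
  by (rule abelian_subgroupI3[OF additive_subgroup.intro[OF R.subgroup_axioms] F.abelian_group_axioms])

lemma coset_eq_iff:
  assumes "x \<in> carrier F" and "y \<in> carrier F"
  shows "R +>\<^bsub>F\<^esub> x = R +>\<^bsub>F\<^esub> y \<longleftrightarrow> x \<ominus>\<^bsub>F\<^esub> y \<in> R"
  using a_repr_independence'[of x y] a_rcos_module[of y x] a_rcos_self[of x] assms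
  by (auto simp: a_minus_def)

lemma mem_Q_cases:
  assumes "U \<in> carrier Q"
  obtains x where "x \<in> carrier F" and "U = R +>\<^bsub>F\<^esub> x"
  using assms by (auto simp: carrier_Q A_RCOSETS_def')

text \<open>An operation on residue classes given by a union over representatives can be evaluated at any
  single representative, provided that it does not depend on the choice.\<close>

lemma UN_coset:
  assumes "x \<in> carrier F" and "\<And>y. \<lbrakk>y \<in> carrier F; y \<ominus>\<^bsub>F\<^esub> x \<in> R\<rbrakk> \<Longrightarrow> h y = c"
  shows "(\<Union>y\<in>R +>\<^bsub>F\<^esub> x. h y) = c"
proof -
  have "h y = c" if "y \<in> R +>\<^bsub>F\<^esub> x" for y
    using assms that a_elemrcos_carrier[of x y] a_rcos_module[of x y]
    by (auto simp: a_minus_def)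
  then show ?thesis using a_rcos_self[OF assms(1)] by blast
qed

lemma smult_coset:
  assumes k: "k \<in> carrier K" and x: "x \<in> carrier F"
  shows "k \<odot>\<^bsub>Q\<^esub> (R +>\<^bsub>F\<^esub> x) = R +>\<^bsub>F\<^esub> (k \<odot>\<^bsub>F\<^esub> x)"
  unfolding smult_Q
proof (rule UN_coset[OF x])
  fix y assume y: "y \<in> carrier F" "y \<ominus>\<^bsub>F\<^esub> x \<in> R"
  have "k \<odot>\<^bsub>F\<^esub> y \<ominus>\<^bsub>F\<^esub> k \<odot>\<^bsub>F\<^esub> x = k \<odot>\<^bsub>F\<^esub> (y \<ominus>\<^bsub>F\<^esub> x)"
    using k x y(1) by (simp add: a_minus_def F.smult_r_distr F.smult_r_minus)
  then show "R +>\<^bsub>F\<^esub> (k \<odot>\<^bsub>F\<^esub> y) = R +>\<^bsub>F\<^esub> (k \<odot>\<^bsub>F\<^esub> x)"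
    using k x y R.smult_closed[OF k y(2)] by (simp add: coset_eq_iff)
qed

lemma add_coset:
  "\<lbrakk>x \<in> carrier F; y \<in> carrier F\<rbrakk> \<Longrightarrow>
    (R +>\<^bsub>F\<^esub> x) \<oplus>\<^bsub>Q\<^esub> (R +>\<^bsub>F\<^esub> y) = R +>\<^bsub>F\<^esub> (x \<oplus>\<^bsub>F\<^esub> y)"
  by (simp add: add_Q a_rcos_sum)

lemma coset_closed: "x \<in> carrier F \<Longrightarrow> R +>\<^bsub>F\<^esub> x \<in> carrier Q"
  by (simp add: carrier_Q F.a_rcosetsI a_subset)

lemma module_Q: "module K Q"
proof -
  have zero: "\<zero>\<^bsub>Q\<^esub> = R +>\<^bsub>F\<^esub> \<zero>\<^bsub>F\<^esub>"
    by (simp add: zero_Q a_subset)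
  have "\<exists>V\<in>carrier Q. V \<oplus>\<^bsub>Q\<^esub> U = \<zero>\<^bsub>Q\<^esub>" if "U \<in> carrier Q" for U
    using that
  proof (rule mem_Q_cases)
    fix x assume "x \<in> carrier F" "U = R +>\<^bsub>F\<^esub> x"
    then show ?thesis
      by (intro bexI[of _ "R +>\<^bsub>F\<^esub> (\<ominus>\<^bsub>F\<^esub> x)"])
        (simp_all add: add_coset coset_closed zero F.l_neg)
  qed
  then interpret Q: abelian_group Q
    by (intro abelian_groupI)
      (auto elim!: mem_Q_cases simp: add_coset coset_closed zero F.a_ac simp del: F.a_coset_add_zero)
  show ?thesis
    by (rule moduleI[OF F.R.is_cring Q.abelian_group_axioms])
      (auto elim!: mem_Q_cases simp: smult_coset add_coset coset_closed F.smult_l_distr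
        F.smult_r_distr F.smult_assoc1)
qed

lemma linear_map_coset: "linear_map K F Q (\<lambda>x. R +>\<^bsub>F\<^esub> x)"
proof -
  interpret Q: module K Q by (rule module_Q)
  show ?thesis by unfold_locales (simp_all add: coset_closed add_coset smult_coset)
qed

lemma coset_span:
  assumes "S \<subseteq> carrier F" and "vs_span K F S = carrier F"
  shows "vs_span K Q ((\<lambda>x. R +>\<^bsub>F\<^esub> x) ` S) = carrier Q"
proof
  interpret coset: linear_map K F Q "\<lambda>x. R +>\<^bsub>F\<^esub> x" by (rule linear_map_coset)
  let ?H = "vs_span K Q ((\<lambda>x. R +>\<^bsub>F\<^esub> x) ` S)"
  have H: "submodule ?H K Q"
    using assms(1) coset_closed by (intro submodule_vs_span[OF module_Q]) auto
  then show "?H \<subseteq> carrier Q" by (rule coset.W.submoduleE(1))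
  have "R +>\<^bsub>F\<^esub> x \<in> ?H" if "x \<in> carrier F" for x
    using vs_span_least[OF coset.submodule_vimage[OF H], of S x] assms that
      vs_span_superset[of "(\<lambda>x. R +>\<^bsub>F\<^esub> x) ` S" K Q] by auto
  then show "carrier Q \<subseteq> ?H" by (auto elim: mem_Q_cases)
qed

lemma linear_map_descends:
  assumes "linear_map K F W f" and "\<And>x. x \<in> R \<Longrightarrow> f x = \<zero>\<^bsub>W\<^esub>"
  obtains f' where "linear_map K Q W f'" and "\<And>x. x \<in> carrier F \<Longrightarrow> f' (R +>\<^bsub>F\<^esub> x) = f x"
proof
  interpret f: linear_map K F W f by fact
  interpret Q: module K Q by (rule module_Q)
  let ?f = "\<lambda>U. the_elem (\<Union>x\<in>U. {f x})"
  show descends: "?f (R +>\<^bsub>F\<^esub> x) = f x" if x: "x \<in> carrier F" for x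
  proof -
    have "f y = f x" if y: "y \<in> carrier F" "y \<ominus>\<^bsub>F\<^esub> x \<in> R" for y
    proof -
      have "f y \<ominus>\<^bsub>W\<^esub> f x = \<zero>\<^bsub>W\<^esub>" using assms(2)[OF y(2)] x y by (simp add: f.map_diff)
      then have "\<ominus>\<^bsub>W\<^esub> (\<ominus>\<^bsub>W\<^esub> f x) = f y"
        using x y f.map_closed by (intro f.W.minus_equality) (auto simp: a_minus_def)
      then show ?thesis using x f.map_closed by simp
    qed
    then have "(\<Union>y\<in>R +>\<^bsub>F\<^esub> x. {f y}) = {f x}" using x by (intro UN_coset) auto
    then show ?thesis by simp
  qed
  show "linear_map K Q W ?f"
    by unfold_locales
      (auto elim!: mem_Q_cases simp: descends add_coset smult_coset f.map_closed f.map_add f.map_smult)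
qed

end


section \<open>Relations in an arbitrary module\<close>

text \<open>The defining relations of the tensor product, read in an arbitrary module \<open>V\<close> in which the
  generator \<open>g\<close> is interpreted as \<open>c g\<close>. That they hold there is expressed by inclusion in \<open>Id\<close>.
  This one notion covers the relations imposed on the free vector space, the identities between
  classes in the quotient, and what is needed for \<open>\<psi>M\<close> and \<open>\<psi>N\<close> to be well defined.\<close>

definition tensor_relations ::
  "('k, 'x) ring_scheme \<Rightarrow> ('k, 'v, 'w) module_scheme \<Rightarrow> ('k, 'm, 'y) awb_scheme \<Rightarrow>
   ('k, 'n, 'z) awb_scheme \<Rightarrow> ('m, 'n) awb_act \<Rightarrow> ('n, 'm) awb_act \<Rightarrow> (('m, 'n) tgen \<Rightarrow> 'v) \<Rightarrow>
   ('v \<times> 'v) set" where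
  "tensor_relations K V M N \<alpha> \<beta> c =
     (let dMN = (\<lambda>m n. c (Dot_MN m n)); dNM = (\<lambda>n m. c (Dot_NM n m));
          sMN = (\<lambda>m n. c (Star_MN m n)); sNM = (\<lambda>n m. c (Star_NM n m))
      in bilinear_rels K V M N dMN \<union> bilinear_rels K V M N sMN \<union>
         bilinear_rels K V N M dNM \<union> bilinear_rels K V N M sNM \<union>
         (\<Union>(uM, uN)\<in>basic_pairs M N \<alpha> \<beta>. \<Union>(vM, vN)\<in>basic_pairs M N \<alpha> \<beta>.
            {(dMN uM vN, dNM uN vM), (sMN uM vN, sNM uN vM)}) \<union>
         action_rels V M N \<alpha> dMN dNM sMN sNM \<union>
         action_rels V N M \<beta> dNM dMN sNM sMN)"

lemma tensor_rels_eq: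
  "tensor_rels K M N \<alpha> \<beta> =
     tensor_relations K (free_vs K (tgens M N)) M N \<alpha> \<beta> (free_gen K)"
  by (simp add: tensor_rels_def tensor_relations_def Let_def)

lemma mem_tgens [simp]:
  "Dot_MN m n \<in> tgens M N \<longleftrightarrow> m \<in> carrier M \<and> n \<in> carrier N"
  "Dot_NM n m \<in> tgens M N \<longleftrightarrow> m \<in> carrier M \<and> n \<in> carrier N"
  "Star_MN m n \<in> tgens M N \<longleftrightarrow> m \<in> carrier M \<and> n \<in> carrier N"
  "Star_NM n m \<in> tgens M N \<longleftrightarrow> m \<in> carrier M \<and> n \<in> carrier N"
  by (auto simp: tgens_def)

fun swap_gen :: "('m, 'n) tgen \<Rightarrow> ('n, 'm) tgen" where
  "swap_gen (Dot_MN m n) = Dot_NM m n"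
| "swap_gen (Dot_NM n m) = Dot_MN n m"
| "swap_gen (Star_MN m n) = Star_NM m n"
| "swap_gen (Star_NM n m) = Star_MN n m"

lemma tpair_swap_gen: "tpair \<beta> \<alpha> (swap_gen g) = prod.swap (tpair \<alpha> \<beta> g)"
  by (cases g) simp_all

lemma swap_gen_mem_tgens [simp]: "swap_gen g \<in> tgens N M \<longleftrightarrow> g \<in> tgens M N"
  by (cases g) auto

lemma swap_gen_swap_gen [simp]: "swap_gen (swap_gen g) = g"
  by (cases g) auto

lemma swap_gen_image: "swap_gen ` tgens M N = tgens N M"
  by (auto simp: image_iff) (metis swap_gen_mem_tgens swap_gen_swap_gen)

lemma basic_pairs_swap: "basic_pairs N M \<beta> \<alpha> = prod.swap ` basic_pairs M N \<alpha> \<beta>"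
  unfolding basic_pairs_def swap_gen_image[of M N, symmetric]
  by (simp add: image_image tpair_swap_gen)

lemma tensor_relations_subset_Id_iff:
  "tensor_relations K V M N \<alpha> \<beta> c \<subseteq> Id \<longleftrightarrow>
     bilinear_rels K V M N (\<lambda>m n. c (Dot_MN m n)) \<subseteq> Id \<and>
     bilinear_rels K V M N (\<lambda>m n. c (Star_MN m n)) \<subseteq> Id \<and>
     bilinear_rels K V N M (\<lambda>n m. c (Dot_NM n m)) \<subseteq> Id \<and>
     bilinear_rels K V N M (\<lambda>n m. c (Star_NM n m)) \<subseteq> Id \<and>
     (\<forall>u\<in>basic_pairs M N \<alpha> \<beta>. \<forall>v\<in>basic_pairs M N \<alpha> \<beta>.
        c (Dot_MN (fst u) (snd v)) = c (Dot_NM (snd u) (fst v)) \<and>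
        c (Star_MN (fst u) (snd v)) = c (Star_NM (snd u) (fst v))) \<and>
     action_rels V M N \<alpha> (\<lambda>m n. c (Dot_MN m n)) (\<lambda>n m. c (Dot_NM n m))
       (\<lambda>m n. c (Star_MN m n)) (\<lambda>n m. c (Star_NM n m)) \<subseteq> Id \<and>
     action_rels V N M \<beta> (\<lambda>n m. c (Dot_NM n m)) (\<lambda>m n. c (Dot_MN m n))
       (\<lambda>n m. c (Star_NM n m)) (\<lambda>m n. c (Star_MN m n)) \<subseteq> Id"
  by (simp only: tensor_relations_def Let_def split_beta Un_subset_iff UN_subset_iff
    insert_subset empty_subsetI pair_in_Id_conv simp_thms conj_ac)

text \<open>Exchanging \<open>M\<close> and \<open>N\<close> permutes the bilinearity and action relations and reverses the
  balancing relations between basic pairs. This is what makes every result about \<open>M\<close> available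
  for \<open>N\<close>.\<close>

lemma tensor_relations_swap:
  assumes "tensor_relations K V M N \<alpha> \<beta> c \<subseteq> Id"
  shows "tensor_relations K V N M \<beta> \<alpha> (\<lambda>g. c (swap_gen g)) \<subseteq> Id"
  using assms unfolding tensor_relations_subset_Id_iff swap_gen.simps
  by (simp add: basic_pairs_swap[of N M])

lemma comprehension_subset_Id_iff:
  "{(f a b c, g a b c) | a b c. P a b c} \<subseteq> Id \<longleftrightarrow> (\<forall>a b c. P a b c \<longrightarrow> f a b c = g a b c)"
  by blast

lemma bilinear_map_iff_rels:
  "bilinear_map K A B V s \<longleftrightarrow>
    (\<forall>a\<in>carrier A. \<forall>b\<in>carrier B. s a b \<in> carrier V) \<and> bilinear_rels K V A B s \<subseteq> Id"
  unfolding bilinear_map_def bilinear_rels_def Un_subset_iff comprehension_subset_Id_iff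
  by (rule iffI; intro conjI ballI allI impI; metis)


section \<open>Compatible actions\<close>

locale mutual_actions = M: awb K M + N: awb K N + on_N: awb_action K M N \<alpha> + on_M: awb_action K N M \<beta>
  for K :: "('k, 'x) ring_scheme" and M :: "('k, 'm, 'y) awb_scheme"
    and N :: "('k, 'n, 'z) awb_scheme" and \<alpha> :: "('m, 'n) awb_act" and \<beta> :: "('n, 'm) awb_act" +
  assumes compatible: "compatible_actions M N \<alpha> \<beta>"
begin

lemma tpair_closed:
  assumes "g \<in> tgens M N"
  shows "fst (tpair \<alpha> \<beta> g) \<in> carrier M" and "snd (tpair \<alpha> \<beta> g) \<in> carrier N"
  using assms
  by (cases g;
      simp add: bilinear_mapD(1)[OF on_N.ldot_bilinear] bilinear_mapD(1)[OF on_N.rdot_bilinear]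
        bilinear_mapD(1)[OF on_N.lstar_bilinear] bilinear_mapD(1)[OF on_N.rstar_bilinear]
        bilinear_mapD(1)[OF on_M.ldot_bilinear] bilinear_mapD(1)[OF on_M.rdot_bilinear]
        bilinear_mapD(1)[OF on_M.lstar_bilinear] bilinear_mapD(1)[OF on_M.rstar_bilinear])+

lemma compatible_on_M:
  assumes "g \<in> tgens M N" and "m \<in> carrier M"
  shows "rdot \<beta> m (snd (tpair \<alpha> \<beta> g)) = m \<otimes>\<^bsub>M\<^esub> fst (tpair \<alpha> \<beta> g)"
    and "rstar \<beta> m (snd (tpair \<alpha> \<beta> g)) = bracket M m (fst (tpair \<alpha> \<beta> g))"
    and "ldot \<beta> (snd (tpair \<alpha> \<beta> g)) m = fst (tpair \<alpha> \<beta> g) \<otimes>\<^bsub>M\<^esub> m"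
    and "lstar \<beta> (snd (tpair \<alpha> \<beta> g)) m = bracket M (fst (tpair \<alpha> \<beta> g)) m"
proof -
  have "(fst (tpair \<alpha> \<beta> g), snd (tpair \<alpha> \<beta> g)) \<in> basic_pairs M N \<alpha> \<beta>"
    using assms by (simp add: basic_pairs_def)
  moreover have "\<zero>\<^bsub>N\<^esub> \<in> carrier N" by simp
  ultimately show
    "rdot \<beta> m (snd (tpair \<alpha> \<beta> g)) = m \<otimes>\<^bsub>M\<^esub> fst (tpair \<alpha> \<beta> g)"
    "rstar \<beta> m (snd (tpair \<alpha> \<beta> g)) = bracket M m (fst (tpair \<alpha> \<beta> g))"
    "ldot \<beta> (snd (tpair \<alpha> \<beta> g)) m = fst (tpair \<alpha> \<beta> g) \<otimes>\<^bsub>M\<^esub> m"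
    "lstar \<beta> (snd (tpair \<alpha> \<beta> g)) m = bracket M (fst (tpair \<alpha> \<beta> g)) m"
    using compatible assms(2) unfolding compatible_actions_def by blast+
qed

lemma compatible_actions_swap: "compatible_actions N M \<beta> \<alpha>"
  using compatible unfolding compatible_actions_def basic_pairs_swap[of N M] by fastforce

lemma swapped: "mutual_actions K N M \<beta> \<alpha>"
  by (intro mutual_actions.intro mutual_actions_axioms.intro M.awb_axioms N.awb_axioms
    on_N.awb_action_axioms on_M.awb_action_axioms compatible_actions_swap)

text \<open>The relations hold for the first components \<open>g\<^sub>M\<close>. The balancing relations hold because both
  sides are \<open>u\<^sub>M v\<^sub>M\<close> or \<open>[u\<^sub>M, v\<^sub>M]\<close>. In the relations for products in \<open>M\<close>, compatibility replaces the
  action of an element of the form \<open>\<^sup>m\<^sup>\<cdot>n\<close>, \<open>n\<^sup>\<cdot>\<^sup>m\<close>, \<open>\<^sup>m\<^sup>*n\<close> or \<open>n\<^sup>*\<^sup>m\<close> by a product or bracket in \<open>M\<close>,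
  which leaves the axioms relating the action of \<open>N\<close> to the product and bracket of \<open>M\<close>. The
  relations for products in \<open>N\<close> are the axioms relating the action on \<open>M\<close> to the operations
  of \<open>N\<close>.\<close>

lemma relations_fst_tpair:
  "tensor_relations K M M N \<alpha> \<beta> (\<lambda>g. fst (tpair \<alpha> \<beta> g)) \<subseteq> Id"
proof -
  note c = compatible_on_M[of "Dot_MN _ _", simplified] compatible_on_M[of "Dot_NM _ _", simplified]
    compatible_on_M[of "Star_MN _ _", simplified] compatible_on_M[of "Star_NM _ _", simplified]
  have bilinear: "bilinear_rels K M M N (rdot \<beta>) \<subseteq> Id" "bilinear_rels K M M N (rstar \<beta>) \<subseteq> Id"
    "bilinear_rels K M N M (ldot \<beta>) \<subseteq> Id" "bilinear_rels K M N M (lstar \<beta>) \<subseteq> Id"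
    using on_M.ldot_bilinear on_M.rdot_bilinear on_M.lstar_bilinear on_M.rstar_bilinear
    by (simp_all add: bilinear_map_iff_rels)
  have balanced: "rdot \<beta> (fst u) (snd v) = ldot \<beta> (snd u) (fst v) \<and>
      rstar \<beta> (fst u) (snd v) = lstar \<beta> (snd u) (fst v)"
    if "u \<in> basic_pairs M N \<alpha> \<beta>" "v \<in> basic_pairs M N \<alpha> \<beta>" for u v
    using that by (auto simp: basic_pairs_def compatible_on_M tpair_closed)
  have "action_rels M M N \<alpha> (rdot \<beta>) (ldot \<beta>) (rstar \<beta>) (lstar \<beta>) \<subseteq> Id"
    by (auto simp: action_rels_def c on_M.mult_rdot on_M.mult_ldot on_M.mult_rdot_ldot
      on_M.bracket_rdot on_M.bracket_ldot on_M.mult_rstar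
      bilinear_mapD(1)[OF on_M.ldot_bilinear] bilinear_mapD(1)[OF on_M.lstar_bilinear]
      bilinear_mapD(1)[OF M.mult_bilinear] bilinear_mapD(1)[OF M.bracket_bilinear]
      intro: M.M.a_comm)
  moreover have "action_rels M N M \<beta> (ldot \<beta>) (rdot \<beta>) (lstar \<beta>) (rstar \<beta>) \<subseteq> Id"
    by (auto simp: action_rels_def on_M.ldot_mult on_M.rdot_mult on_M.rdot_ldot
      on_M.rstar_ldot on_M.rstar_rdot on_M.lstar_mult)
  ultimately show ?thesis
    unfolding tensor_relations_subset_Id_iff tpair.simps fst_conv
    using bilinear balanced by blast
qed

lemma relations_snd_tpair:
  "tensor_relations K N M N \<alpha> \<beta> (\<lambda>g. snd (tpair \<alpha> \<beta> g)) \<subseteq> Id"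
  using tensor_relations_swap[OF mutual_actions.relations_fst_tpair[OF swapped]]
  by (simp add: tpair_swap_gen)

end


section \<open>The crossed modules of a tensor product\<close>

text \<open>The properties of the tensor product from which everything else follows. The product and the
  bracket are prescribed for all elements, not only for generators, by means of \<open>\<psi>M\<close> and \<open>\<psi>N\<close>.\<close>

locale tensor_model = mutual_actions K M N \<alpha> \<beta> + T: module K T
  for K :: "('k, 'x) ring_scheme" and M :: "('k, 'm, 'y) awb_scheme"
    and N :: "('k, 'n, 'z) awb_scheme" and \<alpha> :: "('m, 'n) awb_act" and \<beta> :: "('n, 'm) awb_act"
    and T :: "('k, 't, 'w) awb_scheme" +
  fixes cl :: "('m, 'n) tgen \<Rightarrow> 't" and \<psi>M :: "'t \<Rightarrow> 'm" and \<psi>N :: "'t \<Rightarrow> 'n"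
  assumes cl_closed: "g \<in> tgens M N \<Longrightarrow> cl g \<in> carrier T"
    and cl_span: "vs_span K T (cl ` tgens M N) = carrier T"
    and cl_relations: "tensor_relations K T M N \<alpha> \<beta> cl \<subseteq> Id"
    and linear_psiM: "linear_map K T M \<psi>M"
    and linear_psiN: "linear_map K T N \<psi>N"
    and psiM_cl: "g \<in> tgens M N \<Longrightarrow> \<psi>M (cl g) = fst (tpair \<alpha> \<beta> g)"
    and psiN_cl: "g \<in> tgens M N \<Longrightarrow> \<psi>N (cl g) = snd (tpair \<alpha> \<beta> g)"
    and mult_T: "\<lbrakk>t \<in> carrier T; s \<in> carrier T\<rbrakk> \<Longrightarrow> t \<otimes>\<^bsub>T\<^esub> s = cl (Dot_MN (\<psi>M t) (\<psi>N s))"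
    and bracket_T: "\<lbrakk>t \<in> carrier T; s \<in> carrier T\<rbrakk> \<Longrightarrow>
      bracket T t s = cl (Star_MN (\<psi>M t) (\<psi>N s))"
begin

lemma psi_closed [simp]:
  "t \<in> carrier T \<Longrightarrow> \<psi>M t \<in> carrier M" "t \<in> carrier T \<Longrightarrow> \<psi>N t \<in> carrier N"
  by (rule linear_map.map_closed[OF linear_psiM] linear_map.map_closed[OF linear_psiN]; assumption)+

lemma cl_gen_closed [simp]:
  assumes "m \<in> carrier M" and "n \<in> carrier N"
  shows "cl (Dot_MN m n) \<in> carrier T" and "cl (Dot_NM n m) \<in> carrier T"
    and "cl (Star_MN m n) \<in> carrier T" and "cl (Star_NM n m) \<in> carrier T"
  using assms by (simp_all add: cl_closed)

lemma bilinear_cl: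
  shows "bilinear_map K M N T (\<lambda>m n. cl (Dot_MN m n))"
    and "bilinear_map K M N T (\<lambda>m n. cl (Star_MN m n))"
    and "bilinear_map K N M T (\<lambda>n m. cl (Dot_NM n m))"
    and "bilinear_map K N M T (\<lambda>n m. cl (Star_NM n m))"
  using cl_relations by (simp_all add: bilinear_map_iff_rels tensor_relations_subset_Id_iff)

lemma cl_action_M:
  assumes "a \<in> carrier M" and "b \<in> carrier M" and "n \<in> carrier N"
  shows "cl (Dot_MN (a \<otimes>\<^bsub>M\<^esub> b) n) = cl (Dot_MN a (ldot \<alpha> b n))"
    and "cl (Dot_NM n (a \<otimes>\<^bsub>M\<^esub> b)) = cl (Dot_NM (rdot \<alpha> n a) b)"
    and "cl (Star_MN (a \<otimes>\<^bsub>M\<^esub> b) n) = cl (Dot_MN a (lstar \<alpha> b n)) \<oplus>\<^bsub>T\<^esub> cl (Dot_NM (lstar \<alpha> a n) b)"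
    and "cl (Star_NM (ldot \<alpha> a n) b) = cl (Dot_MN a (rstar \<alpha> n b)) \<oplus>\<^bsub>T\<^esub> cl (Dot_MN (bracket M a b) n)"
    and "cl (Star_NM (rdot \<alpha> n a) b) = cl (Dot_NM (rstar \<alpha> n b) a) \<oplus>\<^bsub>T\<^esub> cl (Dot_NM n (bracket M a b))"
    and "cl (Dot_NM (ldot \<alpha> a n) b) = cl (Dot_MN a (rdot \<alpha> n b))"
proof -
  have "action_rels T M N \<alpha> (\<lambda>m n. cl (Dot_MN m n)) (\<lambda>n m. cl (Dot_NM n m))
      (\<lambda>m n. cl (Star_MN m n)) (\<lambda>n m. cl (Star_NM n m)) \<subseteq> Id"
    using cl_relations by (simp add: tensor_relations_subset_Id_iff)
  then show "cl (Dot_MN (a \<otimes>\<^bsub>M\<^esub> b) n) = cl (Dot_MN a (ldot \<alpha> b n))"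
    "cl (Dot_NM n (a \<otimes>\<^bsub>M\<^esub> b)) = cl (Dot_NM (rdot \<alpha> n a) b)"
    "cl (Star_MN (a \<otimes>\<^bsub>M\<^esub> b) n) = cl (Dot_MN a (lstar \<alpha> b n)) \<oplus>\<^bsub>T\<^esub> cl (Dot_NM (lstar \<alpha> a n) b)"
    "cl (Star_NM (ldot \<alpha> a n) b) = cl (Dot_MN a (rstar \<alpha> n b)) \<oplus>\<^bsub>T\<^esub> cl (Dot_MN (bracket M a b) n)"
    "cl (Star_NM (rdot \<alpha> n a) b) = cl (Dot_NM (rstar \<alpha> n b) a) \<oplus>\<^bsub>T\<^esub> cl (Dot_NM n (bracket M a b))"
    "cl (Dot_NM (ldot \<alpha> a n) b) = cl (Dot_MN a (rdot \<alpha> n b))"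
    using assms unfolding action_rels_def UN_subset_iff insert_subset pair_in_Id_conv by blast+
qed

lemma eq_on_generators:
  assumes "linear_map K T V f" and "linear_map K T V f'"
    and "\<And>g. g \<in> tgens M N \<Longrightarrow> f (cl g) = f' (cl g)" and "t \<in> carrier T"
  shows "f t = f' t"
proof (rule linear_map_eq_on_span[OF assms(1,2)])
  show "cl ` tgens M N \<subseteq> carrier T" using cl_closed by blast
  show "t \<in> vs_span K T (cl ` tgens M N)" using assms(4) cl_span by simp
qed (use assms(3) in blast)

text \<open>Both sides are linear in \<open>t\<close>, and on generators this is the compatibility of the actions.\<close>

lemma on_M_psiN:
  assumes "t \<in> carrier T" and m: "m \<in> carrier M"
  shows "rdot \<beta> m (\<psi>N t) = m \<otimes>\<^bsub>M\<^esub> \<psi>M t"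
    and "rstar \<beta> m (\<psi>N t) = bracket M m (\<psi>M t)"
    and "ldot \<beta> (\<psi>N t) m = \<psi>M t \<otimes>\<^bsub>M\<^esub> m"
    and "lstar \<beta> (\<psi>N t) m = bracket M (\<psi>M t) m"
proof -
  note left = linear_map_compose[OF _ bilinear_map_left[OF _ _ M.module_axioms m]]
    and right = linear_map_compose[OF _ bilinear_map_right[OF _ _ M.module_axioms m]]
  show "rdot \<beta> m (\<psi>N t) = m \<otimes>\<^bsub>M\<^esub> \<psi>M t"
    by (rule eq_on_generators[OF right[OF linear_psiN on_M.rdot_bilinear N.module_axioms]
          right[OF linear_psiM M.mult_bilinear M.module_axioms] _ assms(1)])
      (simp add: psiM_cl psiN_cl compatible_on_M m)
  show "rstar \<beta> m (\<psi>N t) = bracket M m (\<psi>M t)"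
    by (rule eq_on_generators[OF right[OF linear_psiN on_M.rstar_bilinear N.module_axioms]
          right[OF linear_psiM M.bracket_bilinear M.module_axioms] _ assms(1)])
      (simp add: psiM_cl psiN_cl compatible_on_M m)
  show "ldot \<beta> (\<psi>N t) m = \<psi>M t \<otimes>\<^bsub>M\<^esub> m"
    by (rule eq_on_generators[OF left[OF linear_psiN on_M.ldot_bilinear N.module_axioms]
          left[OF linear_psiM M.mult_bilinear M.module_axioms] _ assms(1)])
      (simp add: psiM_cl psiN_cl compatible_on_M m)
  show "lstar \<beta> (\<psi>N t) m = bracket M (\<psi>M t) m"
    by (rule eq_on_generators[OF left[OF linear_psiN on_M.lstar_bilinear N.module_axioms]
          left[OF linear_psiM M.bracket_bilinear M.module_axioms] _ assms(1)])
      (simp add: psiM_cl psiN_cl compatible_on_M m)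
qed

text \<open>For \<open>t\<close> and \<open>s\<close> generators these are the relations between basic pairs. Both sides are bilinear
  in \<open>(t, s)\<close>, so they extend first in \<open>s\<close>, then in \<open>t\<close>.\<close>

lemma balanced:
  assumes t: "t \<in> carrier T" and s: "s \<in> carrier T"
  shows "cl (Dot_NM (\<psi>N t) (\<psi>M s)) = cl (Dot_MN (\<psi>M t) (\<psi>N s))"
    and "cl (Star_NM (\<psi>N t) (\<psi>M s)) = cl (Star_MN (\<psi>M t) (\<psi>N s))"
proof -
  note left = linear_map_compose[OF _ bilinear_map_left[OF _ _ T.module_axioms]]
    and right = linear_map_compose[OF _ bilinear_map_right[OF _ _ T.module_axioms]]
  have gens: "cl (Dot_NM (snd (tpair \<alpha> \<beta> g)) (fst (tpair \<alpha> \<beta> h))) =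
        cl (Dot_MN (fst (tpair \<alpha> \<beta> g)) (snd (tpair \<alpha> \<beta> h)))"
      "cl (Star_NM (snd (tpair \<alpha> \<beta> g)) (fst (tpair \<alpha> \<beta> h))) =
        cl (Star_MN (fst (tpair \<alpha> \<beta> g)) (snd (tpair \<alpha> \<beta> h)))"
    if "g \<in> tgens M N" "h \<in> tgens M N" for g h
    using cl_relations that unfolding tensor_relations_subset_Id_iff basic_pairs_def by simp_all
  have half: "cl (Dot_NM (snd (tpair \<alpha> \<beta> g)) (\<psi>M s)) = cl (Dot_MN (fst (tpair \<alpha> \<beta> g)) (\<psi>N s))"
      "cl (Star_NM (snd (tpair \<alpha> \<beta> g)) (\<psi>M s)) = cl (Star_MN (fst (tpair \<alpha> \<beta> g)) (\<psi>N s))"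
    if g: "g \<in> tgens M N" for g
    by (rule eq_on_generators[OF right[OF linear_psiM bilinear_cl(3) M.module_axioms tpair_closed(2)[OF g]]
          right[OF linear_psiN bilinear_cl(1) N.module_axioms tpair_closed(1)[OF g]] _ s],
        simp add: psiM_cl psiN_cl gens g)
      (rule eq_on_generators[OF right[OF linear_psiM bilinear_cl(4) M.module_axioms tpair_closed(2)[OF g]]
          right[OF linear_psiN bilinear_cl(2) N.module_axioms tpair_closed(1)[OF g]] _ s],
        simp add: psiM_cl psiN_cl gens g)
  show "cl (Dot_NM (\<psi>N t) (\<psi>M s)) = cl (Dot_MN (\<psi>M t) (\<psi>N s))"
    by (rule eq_on_generators[OF left[OF linear_psiN bilinear_cl(3) N.module_axioms psi_closed(1)[OF s]]
          left[OF linear_psiM bilinear_cl(1) M.module_axioms psi_closed(2)[OF s]] _ t])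
      (simp add: psiM_cl psiN_cl half)
  show "cl (Star_NM (\<psi>N t) (\<psi>M s)) = cl (Star_MN (\<psi>M t) (\<psi>N s))"
    by (rule eq_on_generators[OF left[OF linear_psiN bilinear_cl(4) N.module_axioms psi_closed(1)[OF s]]
          left[OF linear_psiM bilinear_cl(2) M.module_axioms psi_closed(2)[OF s]] _ t])
      (simp add: psiM_cl psiN_cl half)
qed

text \<open>The product was defined by \<open>\<psi>M t \<odot> \<psi>N s\<close>; that it is also \<open>\<psi>N t \<odot> \<psi>M s\<close>, and likewise for
  the bracket, is exactly \<open>balanced\<close>.\<close>

lemma swapped_model: "tensor_model K N M \<beta> \<alpha> T (\<lambda>g. cl (swap_gen g)) \<psi>N \<psi>M"
proof (intro tensor_model.intro tensor_model_axioms.intro swapped T.module_axioms)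
  have "(\<lambda>g. cl (swap_gen g)) ` tgens N M = cl ` tgens M N"
    by (metis image_image swap_gen_image)
  then show "vs_span K T ((\<lambda>g. cl (swap_gen g)) ` tgens N M) = carrier T"
    by (simp add: cl_span)
qed (simp_all add: cl_closed linear_psiM linear_psiN psiM_cl psiN_cl tpair_swap_gen[of \<alpha> \<beta>]
  mult_T bracket_T balanced tensor_relations_swap[OF cl_relations])

lemmas cl_action_N = tensor_model.cl_action_M[OF swapped_model, simplified]

lemmas on_N_psiM = tensor_model.on_M_psiN[OF swapped_model]

lemma psi_gen [simp]:
  assumes "m \<in> carrier M" and "n \<in> carrier N"
  shows "\<psi>M (cl (Dot_MN m n)) = rdot \<beta> m n" and "\<psi>N (cl (Dot_MN m n)) = ldot \<alpha> m n"
    and "\<psi>M (cl (Dot_NM n m)) = ldot \<beta> n m" and "\<psi>N (cl (Dot_NM n m)) = rdot \<alpha> n m"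
    and "\<psi>M (cl (Star_MN m n)) = rstar \<beta> m n" and "\<psi>N (cl (Star_MN m n)) = lstar \<alpha> m n"
    and "\<psi>M (cl (Star_NM n m)) = lstar \<beta> n m" and "\<psi>N (cl (Star_NM n m)) = rstar \<alpha> n m"
  using assms by (simp_all add: psiM_cl psiN_cl)

lemma psi_mult:
  assumes "t \<in> carrier T" and "s \<in> carrier T"
  shows "\<psi>M (t \<otimes>\<^bsub>T\<^esub> s) = \<psi>M t \<otimes>\<^bsub>M\<^esub> \<psi>M s" and "\<psi>N (t \<otimes>\<^bsub>T\<^esub> s) = \<psi>N t \<otimes>\<^bsub>N\<^esub> \<psi>N s"
    and "\<psi>M (bracket T t s) = bracket M (\<psi>M t) (\<psi>M s)"
    and "\<psi>N (bracket T t s) = bracket N (\<psi>N t) (\<psi>N s)"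
  using assms by (simp_all add: mult_T bracket_T on_M_psiN on_N_psiM)

lemma T_closed:
  assumes "t \<in> carrier T" and "s \<in> carrier T"
  shows "t \<otimes>\<^bsub>T\<^esub> s \<in> carrier T" and "bracket T t s \<in> carrier T"
  using assms by (simp_all add: mult_T bracket_T)

text \<open>As a left factor the product \<open>ab\<close> only enters through \<open>\<psi>M (ab) = \<psi>M a \<psi>M b\<close>, so
  associativity and the bracket identity are the relations for
  \<open>(m\<^sub>1m\<^sub>2) \<odot> n\<close> and \<open>(m\<^sub>1m\<^sub>2) \<circledast> n\<close>.\<close>

lemma awb_T: "awb K T"
proof (intro awb.intro awb_axioms.intro)
  show "field K" by (rule M.field_axioms)
  show "module K T" by (rule T.module_axioms)
  show "bilinear_map K T T T (\<otimes>\<^bsub>T\<^esub>)"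
    using bilinear_map_compose[OF bilinear_cl(1) linear_psiM linear_psiN]
    by (simp add: bilinear_map_def mult_T)
  show "bilinear_map K T T T (bracket T)"
    using bilinear_map_compose[OF bilinear_cl(2) linear_psiM linear_psiN]
    by (simp add: bilinear_map_def bracket_T)
  fix a b c assume abc: "a \<in> carrier T" "b \<in> carrier T" "c \<in> carrier T"
  show "a \<otimes>\<^bsub>T\<^esub> b \<otimes>\<^bsub>T\<^esub> c = a \<otimes>\<^bsub>T\<^esub> (b \<otimes>\<^bsub>T\<^esub> c)"
    using abc by (simp add: mult_T[of _ c] mult_T[of a] T_closed psi_mult cl_action_M on_N_psiM
      on_M_psiN)
  have "bracket T (a \<otimes>\<^bsub>T\<^esub> b) c = cl (Star_MN (\<psi>M a \<otimes>\<^bsub>M\<^esub> \<psi>M b) (\<psi>N c))"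
    using abc by (simp add: bracket_T psi_mult T_closed)
  also have "\<dots> = cl (Dot_MN (\<psi>M a) (\<psi>N (bracket T b c))) \<oplus>\<^bsub>T\<^esub>
      cl (Dot_NM (\<psi>N (bracket T a c)) (\<psi>M b))"
    using abc by (simp add: cl_action_M psi_mult on_N_psiM)
  also have "\<dots> = a \<otimes>\<^bsub>T\<^esub> bracket T b c \<oplus>\<^bsub>T\<^esub> bracket T a c \<otimes>\<^bsub>T\<^esub> b"
    using abc by (simp add: balanced mult_T T_closed)
  also have "\<dots> = bracket T a c \<otimes>\<^bsub>T\<^esub> b \<oplus>\<^bsub>T\<^esub> a \<otimes>\<^bsub>T\<^esub> bracket T b c"
    using abc by (intro T.M.a_comm T_closed)
  finally show "bracket T (a \<otimes>\<^bsub>T\<^esub> b) c = bracket T a c \<otimes>\<^bsub>T\<^esub> b \<oplus>\<^bsub>T\<^esub> a \<otimes>\<^bsub>T\<^esub> bracket T b c" .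
qed

definition act_M :: "('m, 't) awb_act" where
  "act_M = \<lparr>ldot = \<lambda>m t. cl (Dot_MN m (\<psi>N t)), rdot = \<lambda>t m. cl (Dot_NM (\<psi>N t) m),
     lstar = \<lambda>m t. cl (Star_MN m (\<psi>N t)), rstar = \<lambda>t m. cl (Star_NM (\<psi>N t) m)\<rparr>"

lemma act_M_simps:
  "ldot act_M m t = cl (Dot_MN m (\<psi>N t))" "rdot act_M t m = cl (Dot_NM (\<psi>N t) m)"
  "lstar act_M m t = cl (Star_MN m (\<psi>N t))" "rstar act_M t m = cl (Star_NM (\<psi>N t) m)"
  by (simp_all add: act_M_def)

text \<open>The six axioms about products and brackets in \<open>M\<close> are the relations for products in \<open>M\<close>, with
  \<open>\<psi>N t\<close> for the element of \<open>N\<close>. The six axioms about products and brackets in \<open>T\<close> are the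
  relations for products in \<open>N\<close>, since \<open>m\<close> is paired with elements \<open>\<psi>N t\<close> and
  \<open>\<psi>N\<close> is multiplicative.\<close>

lemma awb_action_act_M: "awb_action K M T act_M"
proof (intro awb_action.intro awb_action_axioms.intro M.awb_axioms awb_T)
  show "bilinear_map K M T T (ldot act_M)"
    using bilinear_map_compose[OF bilinear_cl(1) linear_map_id[OF M.module_axioms] linear_psiN]
    by (simp add: act_M_def)
  show "bilinear_map K M T T (lstar act_M)"
    using bilinear_map_compose[OF bilinear_cl(2) linear_map_id[OF M.module_axioms] linear_psiN]
    by (simp add: act_M_def)
  show "bilinear_map K T M T (rdot act_M)"
    using bilinear_map_compose[OF bilinear_cl(3) linear_psiN linear_map_id[OF M.module_axioms]]
    by (simp add: act_M_def)
  show "bilinear_map K T M T (rstar act_M)"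
    using bilinear_map_compose[OF bilinear_cl(4) linear_psiN linear_map_id[OF M.module_axioms]]
    by (simp add: act_M_def)
next
  fix a b t assume "a \<in> carrier M" "b \<in> carrier M" "t \<in> carrier T"
  then show "ldot act_M (a \<otimes>\<^bsub>M\<^esub> b) t = ldot act_M a (ldot act_M b t)"
    and "rdot act_M t (a \<otimes>\<^bsub>M\<^esub> b) = rdot act_M (rdot act_M t a) b"
    and "rdot act_M (ldot act_M a t) b = ldot act_M a (rdot act_M t b)"
    and "rstar act_M (ldot act_M a t) b = ldot act_M a (rstar act_M t b) \<oplus>\<^bsub>T\<^esub> ldot act_M (bracket M a b) t"
    and "rstar act_M (rdot act_M t a) b = rdot act_M (rstar act_M t b) a \<oplus>\<^bsub>T\<^esub> rdot act_M t (bracket M a b)"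
    and "lstar act_M (a \<otimes>\<^bsub>M\<^esub> b) t = ldot act_M a (lstar act_M b t) \<oplus>\<^bsub>T\<^esub> rdot act_M (lstar act_M a t) b"
    by (simp_all add: act_M_simps cl_action_M)
next
  fix m t s assume mts [simp]: "m \<in> carrier M" "t \<in> carrier T" "s \<in> carrier T"
  have closed: "ldot act_M m u \<in> carrier T" "rdot act_M u m \<in> carrier T"
      "lstar act_M m u \<in> carrier T" "rstar act_M u m \<in> carrier T" if "u \<in> carrier T" for u
    using that by (simp_all add: act_M_simps)
  \<comment> \<open>The relation that proves an axiom decides whether a product has to be written as
    \<open>\<psi>N t \<odot> \<psi>M u\<close> or, by its definition, as \<open>\<psi>M t \<odot> \<psi>N u\<close>.\<close>
  have dot_NM: "t \<otimes>\<^bsub>T\<^esub> u = cl (Dot_NM (\<psi>N t) (\<psi>M u))" if "u \<in> carrier T" for u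
    using that by (simp add: mult_T balanced)
  show "rdot act_M (t \<otimes>\<^bsub>T\<^esub> s) m = t \<otimes>\<^bsub>T\<^esub> rdot act_M s m"
    by (simp add: dot_NM[of "rdot act_M s m"] closed) (simp add: act_M_simps psi_mult cl_action_N)
  show "ldot act_M m (t \<otimes>\<^bsub>T\<^esub> s) = ldot act_M m t \<otimes>\<^bsub>T\<^esub> s"
    by (simp add: mult_T[of "ldot act_M m t"] closed) (simp add: act_M_simps psi_mult cl_action_N)
  show "rdot act_M t m \<otimes>\<^bsub>T\<^esub> s = t \<otimes>\<^bsub>T\<^esub> ldot act_M m s"
    by (simp add: dot_NM mult_T[of "rdot act_M t m"] closed) (simp add: act_M_simps cl_action_N)
  show "bracket T (rdot act_M t m) s = t \<otimes>\<^bsub>T\<^esub> lstar act_M m s \<oplus>\<^bsub>T\<^esub> rdot act_M (bracket T t s) m"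
    by (simp add: dot_NM bracket_T[of "rdot act_M t m"] closed) (simp add: act_M_simps psi_mult cl_action_N)
  have "bracket T (ldot act_M m t) s = lstar act_M m s \<otimes>\<^bsub>T\<^esub> t \<oplus>\<^bsub>T\<^esub> ldot act_M m (bracket T t s)"
    by (simp add: mult_T bracket_T[of "ldot act_M m t"] closed) (simp add: act_M_simps psi_mult cl_action_N)
  also have "\<dots> = ldot act_M m (bracket T t s) \<oplus>\<^bsub>T\<^esub> lstar act_M m s \<otimes>\<^bsub>T\<^esub> t"
    by (intro T.M.a_comm T_closed closed mts)
  finally show "bracket T (ldot act_M m t) s =
      ldot act_M m (bracket T t s) \<oplus>\<^bsub>T\<^esub> lstar act_M m s \<otimes>\<^bsub>T\<^esub> t" .
  show "rstar act_M (t \<otimes>\<^bsub>T\<^esub> s) m = t \<otimes>\<^bsub>T\<^esub> rstar act_M s m \<oplus>\<^bsub>T\<^esub> rstar act_M t m \<otimes>\<^bsub>T\<^esub> s"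
    by (simp add: dot_NM[of "rstar act_M s m"] mult_T[of "rstar act_M t m"] closed)
      (simp add: act_M_simps psi_mult cl_action_N)
qed

lemma awb_hom_psiM: "awb_hom K T M \<psi>M"
proof -
  interpret linear_map K T M \<psi>M by (rule linear_psiM)
  show ?thesis
    by (intro awb_hom.intro awb_hom_axioms.intro awb_T M.awb_axioms)
      (simp_all add: map_add map_smult psi_mult)
qed

lemma crossed_module_psiM: "awb_crossed_module K T M \<psi>M act_M"
  by (intro awb_crossed_module.intro awb_crossed_module_axioms.intro awb_hom_psiM awb_action_act_M conjI)
    (simp_all add: act_M_simps on_M_psiN mult_T bracket_T balanced)

lemma act_M_cl:
  assumes "m \<in> carrier M" and "g \<in> tgens M N"
  shows "ldot act_M m (cl g) = cl (Dot_MN m (snd (tpair \<alpha> \<beta> g)))"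
    and "rdot act_M (cl g) m = cl (Dot_NM (snd (tpair \<alpha> \<beta> g)) m)"
    and "lstar act_M m (cl g) = cl (Star_MN m (snd (tpair \<alpha> \<beta> g)))"
    and "rstar act_M (cl g) m = cl (Star_NM (snd (tpair \<alpha> \<beta> g)) m)"
  using assms by (simp_all add: act_M_simps psiN_cl)

end


section \<open>The quotient by the defining relations\<close>

lemma map_prod_comprehension:
  assumes "\<And>a b c. P a b c \<Longrightarrow> L (f a b c) = f' a b c \<and> L (g a b c) = g' a b c"
  shows "map_prod L L ` {(f a b c, g a b c) | a b c. P a b c} =
    {(f' a b c, g' a b c) | a b c. P a b c}"
  using assms by (auto simp: image_iff) (metis assms)+

text \<open>Relations are carried along linear maps exactly, that is as equalities of sets. For a map \<open>L\<close>
  out of the free vector space one needs that the images of relations are relations in the target; for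
  the projection to the quotient, that all relations there arise in this way.\<close>

lemma map_prod_bilinear_rels:
  assumes "linear_map K F V L" and "module K A" and "module K B"
    and s: "\<And>a b. \<lbrakk>a \<in> carrier A; b \<in> carrier B\<rbrakk> \<Longrightarrow> s a b \<in> carrier F \<and> L (s a b) = s' a b"
  shows "map_prod L L ` bilinear_rels K F A B s = bilinear_rels K V A B s'"
proof -
  interpret linear_map K F V L by fact
  interpret A: module K A by fact
  interpret B: module K B by fact
  show ?thesis
    unfolding bilinear_rels_def image_Un
    by (intro arg_cong2[of _ _ _ _ "(\<union>)"] map_prod_comprehension)
      (simp_all add: s map_add map_smult)
qed

lemma bilinear_rels_closed:
  assumes "module K F" and "module K A" and "module K B"
    and s: "\<And>a b. \<lbrakk>a \<in> carrier A; b \<in> carrier B\<rbrakk> \<Longrightarrow> s a b \<in> carrier F"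
  shows "bilinear_rels K F A B s \<subseteq> carrier F \<times> carrier F"
proof -
  interpret F: module K F by fact
  interpret A: module K A by fact
  interpret B: module K B by fact
  show ?thesis unfolding bilinear_rels_def by (auto simp: s)
qed

lemma action_rels_transport:
  assumes "linear_map K F V L" and "awb_action K A B \<gamma>"
    and d: "\<And>a b. \<lbrakk>a \<in> carrier A; b \<in> carrier B\<rbrakk> \<Longrightarrow> dAB a b \<in> carrier F \<and> L (dAB a b) = dAB' a b"
      "\<And>a b. \<lbrakk>a \<in> carrier A; b \<in> carrier B\<rbrakk> \<Longrightarrow> dBA b a \<in> carrier F \<and> L (dBA b a) = dBA' b a"
      "\<And>a b. \<lbrakk>a \<in> carrier A; b \<in> carrier B\<rbrakk> \<Longrightarrow> sAB a b \<in> carrier F \<and> L (sAB a b) = sAB' a b"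
      "\<And>a b. \<lbrakk>a \<in> carrier A; b \<in> carrier B\<rbrakk> \<Longrightarrow> sBA b a \<in> carrier F \<and> L (sBA b a) = sBA' b a"
  shows "map_prod L L ` action_rels F A B \<gamma> dAB dBA sAB sBA = action_rels V A B \<gamma> dAB' dBA' sAB' sBA'"
    and "action_rels F A B \<gamma> dAB dBA sAB sBA \<subseteq> carrier F \<times> carrier F"
proof -
  interpret linear_map K F V L by fact
  interpret awb_action K A B \<gamma> by fact
  note closed = bilinear_mapD(1)[OF ldot_bilinear] bilinear_mapD(1)[OF rdot_bilinear]
    bilinear_mapD(1)[OF lstar_bilinear] bilinear_mapD(1)[OF rstar_bilinear]
    bilinear_mapD(1)[OF A.mult_bilinear] bilinear_mapD(1)[OF A.bracket_bilinear]
  show "map_prod L L ` action_rels F A B \<gamma> dAB dBA sAB sBA = action_rels V A B \<gamma> dAB' dBA' sAB' sBA'"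
    unfolding action_rels_def image_UN image_insert image_empty map_prod_simp
    by (intro SUP_cong refl) (simp add: d closed map_add)
  show "action_rels F A B \<gamma> dAB dBA sAB sBA \<subseteq> carrier F \<times> carrier F"
    unfolding action_rels_def by (auto simp: d closed)
qed

context mutual_actions
begin

lemma tensor_relations_transport:
  assumes L: "linear_map K F V L"
    and c: "\<And>g. g \<in> tgens M N \<Longrightarrow> c g \<in> carrier F \<and> L (c g) = c' g"
  shows "map_prod L L ` tensor_relations K F M N \<alpha> \<beta> c = tensor_relations K V M N \<alpha> \<beta> c'"
    and "tensor_relations K F M N \<alpha> \<beta> c \<subseteq> carrier F \<times> carrier F"
proof -
  interpret linear_map K F V L by fact
  have pair: "fst u \<in> carrier M" "snd u \<in> carrier N" if "u \<in> basic_pairs M N \<alpha> \<beta>" for u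
    using that tpair_closed by (auto simp: basic_pairs_def)
  then have pair': "m \<in> carrier M \<and> n \<in> carrier N" if "(m, n) \<in> basic_pairs M N \<alpha> \<beta>" for m n
    using that by force
  have balanced: "map_prod L L ` (\<Union>u\<in>basic_pairs M N \<alpha> \<beta>. \<Union>v\<in>basic_pairs M N \<alpha> \<beta>.
        {(c (Dot_MN (fst u) (snd v)), c (Dot_NM (snd u) (fst v))),
         (c (Star_MN (fst u) (snd v)), c (Star_NM (snd u) (fst v)))}) =
      (\<Union>u\<in>basic_pairs M N \<alpha> \<beta>. \<Union>v\<in>basic_pairs M N \<alpha> \<beta>.
        {(c' (Dot_MN (fst u) (snd v)), c' (Dot_NM (snd u) (fst v))),
         (c' (Star_MN (fst u) (snd v)), c' (Star_NM (snd u) (fst v)))})"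
    unfolding image_UN image_insert image_empty map_prod_simp
    by (intro SUP_cong refl) (simp add: c pair)
  show "map_prod L L ` tensor_relations K F M N \<alpha> \<beta> c = tensor_relations K V M N \<alpha> \<beta> c'"
    unfolding tensor_relations_def Let_def image_Un split_beta balanced
    by (intro arg_cong2[of _ _ _ _ "(\<union>)"] refl map_prod_bilinear_rels[OF L]
        action_rels_transport(1)[OF L] M.module_axioms N.module_axioms
        on_N.awb_action_axioms on_M.awb_action_axioms)
      (simp_all add: c)
  show "tensor_relations K F M N \<alpha> \<beta> c \<subseteq> carrier F \<times> carrier F"
    unfolding tensor_relations_def Let_def split_beta Un_subset_iff
    by (intro conjI bilinear_rels_closed action_rels_transport(2)[OF L] M.module_axioms N.module_axioms
        on_N.awb_action_axioms on_M.awb_action_axioms V.module_axioms)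
      (auto simp: c dest!: pair')
qed

abbreviation F where "F \<equiv> free_vs K (tgens M N)"
abbreviation R where "R \<equiv> tensor_kernel K M N \<alpha> \<beta>"
abbreviation T where "T \<equiv> nonab_tensor K M N \<alpha> \<beta>"
abbreviation cl where "cl \<equiv> tclass K M N \<alpha> \<beta>"
abbreviation differences where
  "differences \<equiv> {l \<ominus>\<^bsub>F\<^esub> r | l r. (l, r) \<in> tensor_rels K M N \<alpha> \<beta>}"

lemma cring_K: "cring K"
  by (rule module.axioms(1)[OF M.module_axioms])

lemma module_F: "module K F"
  by (rule module_free_vs[OF cring_K])

lemma gen_closed: "g \<in> tgens M N \<Longrightarrow> free_gen K g \<in> carrier F"
  by (rule free_gen_closed[OF cring_K])

lemma tensor_rels_closed: "tensor_rels K M N \<alpha> \<beta> \<subseteq> carrier F \<times> carrier F"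
  unfolding tensor_rels_eq
  by (rule tensor_relations_transport(2)[OF linear_map_id[OF module_F]]) (simp add: gen_closed)

lemma differences_closed: "differences \<subseteq> carrier F"
proof -
  interpret F: module K F by (rule module_F)
  show ?thesis using tensor_rels_closed by (auto intro: F.minus_closed)
qed

lemma quotient_space_T: "quotient_space K F R T"
proof (intro quotient_space.intro quotient_space_axioms.intro module_F)
  show "submodule R K F"
    using submodule_vs_span[OF module_F differences_closed] by (simp add: tensor_kernel_def Let_def)
qed (simp_all add: nonab_tensor_def Let_def)

lemma cl_eq: "cl g = R +>\<^bsub>F\<^esub> free_gen K g"
  by (simp add: tclass_def)

text \<open>This is what allows a map given on generators to descend to the quotient. Relations go to
  relations between the values \<open>c g\<close>, so the linear extension vanishes on the differences of their
  two sides, and these span the kernel.\<close>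

lemma linear_ext_vanishes:
  assumes "module K V" and c: "\<And>g. g \<in> tgens M N \<Longrightarrow> c g \<in> carrier V"
    and "tensor_relations K V M N \<alpha> \<beta> c \<subseteq> Id" and "x \<in> R"
  shows "linear_ext K V c x = \<zero>\<^bsub>V\<^esub>"
proof -
  interpret ext: linear_map K F V "linear_ext K V c"
    using assms(1) c by (rule linear_map_linear_ext)
  have respects: "linear_ext K V c l = linear_ext K V c r" if "(l, r) \<in> tensor_rels K M N \<alpha> \<beta>" for l r
  proof -
    have "map_prod (linear_ext K V c) (linear_ext K V c) (l, r) \<in> tensor_relations K V M N \<alpha> \<beta> c"
      using that tensor_relations_transport(1)[OF ext.linear_map_axioms, of "free_gen K" c]
      by (auto simp: gen_closed linear_ext_free_gen[OF assms(1)] c tensor_rels_eq)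
    with assms(3) show ?thesis by auto
  qed
  have "linear_ext K V c y = \<zero>\<^bsub>V\<^esub>" if y: "y \<in> differences" for y
  proof -
    obtain l r where lr: "(l, r) \<in> tensor_rels K M N \<alpha> \<beta>" "y = l \<ominus>\<^bsub>F\<^esub> r"
      using y by blast
    then have "l \<in> carrier F" "r \<in> carrier F"
      using tensor_rels_closed by auto
    with respects[OF lr(1)] show ?thesis
      by (simp add: lr(2) ext.map_add ext.map_minus ext.map_closed ext.W.M.r_neg a_minus_def)
  qed
  moreover have "x \<in> vs_span K F differences"
    using \<open>x \<in> R\<close> by (simp add: tensor_kernel_def Let_def)
  ultimately show ?thesis
    using linear_map_eq_on_span[OF ext.linear_map_axioms
        linear_map_zero[OF module_F assms(1)] differences_closed] by blast
qed

lemma relations_T: "tensor_relations K T M N \<alpha> \<beta> cl \<subseteq> Id"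
proof -
  interpret quotient_space K F R T by (rule quotient_space_T)
  have "R +>\<^bsub>F\<^esub> l = R +>\<^bsub>F\<^esub> r" if "(l, r) \<in> tensor_rels K M N \<alpha> \<beta>" for l r
  proof -
    have "l \<ominus>\<^bsub>F\<^esub> r \<in> R"
      using that vs_span_superset[of differences K F] by (auto simp: tensor_kernel_def Let_def)
    moreover have "l \<in> carrier F" "r \<in> carrier F"
      using that tensor_rels_closed by auto
    ultimately show ?thesis by (simp add: coset_eq_iff)
  qed
  then have "map_prod (\<lambda>x. R +>\<^bsub>F\<^esub> x) (\<lambda>x. R +>\<^bsub>F\<^esub> x) ` tensor_rels K M N \<alpha> \<beta> \<subseteq> Id"
    by auto
  then show ?thesis
    using tensor_relations_transport(1)[OF linear_map_coset, of "free_gen K" cl]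
    by (simp add: gen_closed cl_eq tensor_rels_eq)
qed

text \<open>Product and bracket of \<open>T\<close> at once: \<open>gen\<close> is \<open>Dot_MN\<close> or \<open>Star_MN\<close>. For representatives \<open>x\<close>,
  \<open>y\<close> the class of the bilinear extension is determined by the values of \<open>\<psi>M\<close> and \<open>\<psi>N\<close> at the
  classes of \<open>x\<close> and \<open>y\<close>, so all members of the union coincide.\<close>

lemma bilinear_op_T:
  assumes D: "bilinear_map K M N T (\<lambda>m n. cl (gen m n))"
    and gen: "\<And>m n. \<lbrakk>m \<in> carrier M; n \<in> carrier N\<rbrakk> \<Longrightarrow> gen m n \<in> tgens M N"
    and \<psi>: "\<And>x. x \<in> carrier F \<Longrightarrow> \<psi>M (R +>\<^bsub>F\<^esub> x) = linear_ext K M (\<lambda>g. fst (tpair \<alpha> \<beta> g)) x"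
      "\<And>x. x \<in> carrier F \<Longrightarrow> \<psi>N (R +>\<^bsub>F\<^esub> x) = linear_ext K N (\<lambda>g. snd (tpair \<alpha> \<beta> g)) x"
    and U: "U \<in> carrier T" and V: "V \<in> carrier T"
  shows "(\<Union>x\<in>U. \<Union>y\<in>V. R +>\<^bsub>F\<^esub> bilinear_ext K F
      (\<lambda>g h. free_gen K (gen (fst (tpair \<alpha> \<beta> g)) (snd (tpair \<alpha> \<beta> h)))) x y) = cl (gen (\<psi>M U) (\<psi>N V))"
proof -
  interpret quotient_space K F R T by (rule quotient_space_T)
  obtain u v where u: "u \<in> carrier F" "U = R +>\<^bsub>F\<^esub> u" and v: "v \<in> carrier F" "V = R +>\<^bsub>F\<^esub> v"
    using U V by (auto elim!: mem_Q_cases)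
  show ?thesis
    unfolding u(2) v(2)
  proof (intro UN_coset u(1) v(1))
    fix x y assume x: "x \<in> carrier F" "x \<ominus>\<^bsub>F\<^esub> u \<in> R" and y: "y \<in> carrier F" "y \<ominus>\<^bsub>F\<^esub> v \<in> R"
    have "R +>\<^bsub>F\<^esub> bilinear_ext K F
        (\<lambda>g h. free_gen K (gen (fst (tpair \<alpha> \<beta> g)) (snd (tpair \<alpha> \<beta> h)))) x y =
      cl (gen (linear_ext K M (\<lambda>g. fst (tpair \<alpha> \<beta> g)) x) (linear_ext K N (\<lambda>g. snd (tpair \<alpha> \<beta> g)) y))"
      by (rule linear_map_bilinear_ext[OF linear_map_coset D M.module_axioms N.module_axioms,
            where S = "tgens M N"])
        (simp_all add: x y tpair_closed gen gen_closed cl_eq)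
    also have "\<dots> = cl (gen (\<psi>M (R +>\<^bsub>F\<^esub> u)) (\<psi>N (R +>\<^bsub>F\<^esub> v)))"
      using x y u v by (simp add: \<psi>[symmetric] coset_eq_iff[symmetric])
    finally show "R +>\<^bsub>F\<^esub> bilinear_ext K F
        (\<lambda>g h. free_gen K (gen (fst (tpair \<alpha> \<beta> g)) (snd (tpair \<alpha> \<beta> h)))) x y =
      cl (gen (\<psi>M (R +>\<^bsub>F\<^esub> u)) (\<psi>N (R +>\<^bsub>F\<^esub> v)))" .
  qed
qed

lemma ex_tensor_model: "\<exists>\<psi>M \<psi>N. tensor_model K M N \<alpha> \<beta> T cl \<psi>M \<psi>N"
proof -
  interpret quotient_space K F R T by (rule quotient_space_T)
  let ?fM = "\<lambda>g. fst (tpair \<alpha> \<beta> g)" and ?fN = "\<lambda>g. snd (tpair \<alpha> \<beta> g)"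
  obtain \<psi>M where \<psi>M: "linear_map K T M \<psi>M"
    "\<And>x. x \<in> carrier F \<Longrightarrow> \<psi>M (R +>\<^bsub>F\<^esub> x) = linear_ext K M ?fM x"
    by (rule linear_map_descends[OF linear_map_linear_ext[OF M.module_axioms]
          linear_ext_vanishes[OF M.module_axioms _ relations_fst_tpair]])
      (auto simp: tpair_closed)
  obtain \<psi>N where \<psi>N: "linear_map K T N \<psi>N"
    "\<And>x. x \<in> carrier F \<Longrightarrow> \<psi>N (R +>\<^bsub>F\<^esub> x) = linear_ext K N ?fN x"
    by (rule linear_map_descends[OF linear_map_linear_ext[OF N.module_axioms]
          linear_ext_vanishes[OF N.module_axioms _ relations_snd_tpair]])
      (auto simp: tpair_closed)
  have cl_closed: "cl g \<in> carrier T" if "g \<in> tgens M N" for g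
    using that by (simp add: cl_eq coset_closed gen_closed)
  have bilinear: "bilinear_map K M N T (\<lambda>m n. cl (Dot_MN m n))" "bilinear_map K M N T (\<lambda>m n. cl (Star_MN m n))"
    using relations_T by (simp_all add: bilinear_map_iff_rels tensor_relations_subset_Id_iff cl_closed)
  have "tensor_model K M N \<alpha> \<beta> T cl \<psi>M \<psi>N"
  proof (intro tensor_model.intro tensor_model_axioms.intro mutual_actions_axioms module_Q relations_T
      \<psi>M(1) \<psi>N(1) cl_closed)
    have "cl ` tgens M N = (\<lambda>x. R +>\<^bsub>F\<^esub> x) ` free_gen K ` tgens M N"
      by (simp add: cl_eq image_image)
    then show "vs_span K T (cl ` tgens M N) = carrier T"
      using coset_span[OF _ free_vs_span[OF cring_K]] gen_closed by auto
    show "\<psi>M (cl g) = ?fM g" if "g \<in> tgens M N" for g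
      using that by (simp add: cl_eq gen_closed \<psi>M(2) linear_ext_free_gen[OF M.module_axioms] tpair_closed)
    show "\<psi>N (cl g) = ?fN g" if "g \<in> tgens M N" for g
      using that by (simp add: cl_eq gen_closed \<psi>N(2) linear_ext_free_gen[OF N.module_axioms] tpair_closed)
    show "t \<otimes>\<^bsub>T\<^esub> s = cl (Dot_MN (\<psi>M t) (\<psi>N s))" if "t \<in> carrier T" "s \<in> carrier T" for t s
      using bilinear_op_T[OF bilinear(1) _ \<psi>M(2) \<psi>N(2) that] by (simp add: nonab_tensor_def Let_def)
    show "bracket T t s = cl (Star_MN (\<psi>M t) (\<psi>N s))" if "t \<in> carrier T" "s \<in> carrier T" for t s
      using bilinear_op_T[OF bilinear(2) _ \<psi>M(2) \<psi>N(2) that] by (simp add: nonab_tensor_def Let_def)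
  qed
  then show ?thesis by blast
qed

end

theorem proposition4p7:
  fixes K :: "('k, 'x) ring_scheme"
    and M :: "('k, 'm, 'y) awb_scheme"
    and N :: "('k, 'n, 'z) awb_scheme"
    and \<alpha> :: "('m, 'n) awb_act"
    and \<beta> :: "('n, 'm) awb_act"
  assumes "field K" and "awb K M" and "awb K N"
    and "awb_action K M N \<alpha>" and "awb_action K N M \<beta>"
    and "compatible_actions M N \<alpha> \<beta>"
  shows "let T = nonab_tensor K M N \<alpha> \<beta>;
             cl = tclass K M N \<alpha> \<beta>;
             gM = (\<lambda>g. fst (tpair \<alpha> \<beta> g));
             gN = (\<lambda>g. snd (tpair \<alpha> \<beta> g))
    in \<exists>\<psi>M \<psi>N \<rho>M \<rho>N.
      (awb_hom K T M \<psi>M \<and> (\<forall>g\<in>tgens M N. \<psi>M (cl g) = gM g) \<and>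
       awb_hom K T N \<psi>N \<and> (\<forall>g\<in>tgens M N. \<psi>N (cl g) = gN g)) \<and>
      (awb_action K M T \<rho>M \<and>
       (\<forall>m\<in>carrier M. \<forall>g\<in>tgens M N.
          ldot \<rho>M m (cl g) = cl (Dot_MN m (gN g)) \<and>
          rdot \<rho>M (cl g) m = cl (Dot_NM (gN g) m) \<and>
          lstar \<rho>M m (cl g) = cl (Star_MN m (gN g)) \<and>
          rstar \<rho>M (cl g) m = cl (Star_NM (gN g) m)) \<and>
       awb_action K N T \<rho>N \<and>
       (\<forall>n\<in>carrier N. \<forall>g\<in>tgens M N.
          ldot \<rho>N n (cl g) = cl (Dot_NM n (gM g)) \<and>
          rdot \<rho>N (cl g) n = cl (Dot_MN (gM g) n) \<and>
          lstar \<rho>N n (cl g) = cl (Star_NM n (gM g)) \<and>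
          rstar \<rho>N (cl g) n = cl (Star_MN (gM g) n))) \<and>
      (awb_crossed_module K T M \<psi>M \<rho>M \<and> awb_crossed_module K T N \<psi>N \<rho>N)"
proof -
  interpret mutual_actions K M N \<alpha> \<beta>
    by (intro mutual_actions.intro mutual_actions_axioms.intro assms)
  obtain \<psi>M \<psi>N where model: "tensor_model K M N \<alpha> \<beta> T cl \<psi>M \<psi>N"
    using ex_tensor_model by blast
  interpret onM: tensor_model K M N \<alpha> \<beta> T cl \<psi>M \<psi>N by (rule model)
  interpret onN: tensor_model K N M \<beta> \<alpha> T "\<lambda>g. cl (swap_gen g)" \<psi>N \<psi>M
    by (rule onM.swapped_model)
  have act_N: "ldot onN.act_M n (cl g) = cl (Dot_NM n (fst (tpair \<alpha> \<beta> g)))"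
      "rdot onN.act_M (cl g) n = cl (Dot_MN (fst (tpair \<alpha> \<beta> g)) n)"
      "lstar onN.act_M n (cl g) = cl (Star_NM n (fst (tpair \<alpha> \<beta> g)))"
      "rstar onN.act_M (cl g) n = cl (Star_MN (fst (tpair \<alpha> \<beta> g)) n)"
    if "n \<in> carrier N" "g \<in> tgens M N" for n g
    using that onN.act_M_cl[of n "swap_gen g"] by (simp_all add: tpair_swap_gen[of \<beta> \<alpha>])
  show ?thesis
    unfolding Let_def
    by (rule exI[of _ \<psi>M], rule exI[of _ \<psi>N], rule exI[of _ onM.act_M], rule exI[of _ onN.act_M])
      (simp add: onM.awb_hom_psiM onN.awb_hom_psiM onM.psiM_cl onM.psiN_cl onM.act_M_cl act_N
        onM.awb_action_act_M onN.awb_action_act_M onM.crossed_module_psiM onN.crossed_module_psiM)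
qed

end
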